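(* Let $r=d\in\mathbb{N}$. Assume that $a:\mathbb{R}^r\to\mathbb{R}^r$ is Lipschitz continuous, that $b:\mathbb{R}^r\to\mathbb{R}^{r\times r}$ has bounded first and second order partial derivatives and is of class $C^\infty$ in some neighborhood of $x_0\in\mathbb{R}^r$, and that $\det b(x_0)\neq0$. Let $X$ be the solution on $[0,1]$ of $\mathrm{d}X(t)=a(X(t))\,\mathrm{d}t+b(X(t))\,\mathrm{d}W(t)$, $X(0)=x_0$, with an $r$-dimensional Brownian motion $W$, and let $S(f)=\mathrm{E}(f(X))$ for $f\in\mathrm{Lip}_1$. Then there exist constants $c,\varepsilon_0>0$ such that \[ \mathrm{comp}^{\mathrm{bit}}_{\mathfrak{c}}(\varepsilon)\ge c\cdot\varepsilon^{-2} \] for every $\varepsilon\in(0,\varepsilon_0]$, where $\mathrm{comp}^{\mathrm{bit}}_{\mathfrak{c}}(\varepsilon)$ is the $\varepsilon$-complexity for the approximation of $S$ on $F=\mathrm{Lip}_1$ by random bit Monte Carlo algorithms.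
   Context: Here $\mathfrak{X}=C([0,1],\mathbb{R}^r)$ with the supremum norm $\|\cdot\|$ (w.r.t. the Euclidean norm on $\mathbb{R}^r$), and $F=\mathrm{Lip}_1$ is the class of all $f:\mathfrak{X}\to\mathbb{R}$ with $|f(x)-f(y)|\le\|x-y\|$ for all $x,y\in\mathfrak{X}$. $\mathbb{N}=\{1,2,\dots\}$, $\mathbb{N}_0=\mathbb{N}\cup\{0\}$. Cost function. For $\ell\in\mathbb{N}_0$ let $\mathfrak{X}_\ell$ be the set of all piecewise linear $x\in\mathfrak{X}$ with breakpoints $k/2^\ell$, $k=0,\dots,2^\ell$. The cost of evaluating $f\in F$ at $x\in\mathfrak{X}$ is $\mathfrak{c}(x)=\inf\{2^\ell+1: \ell\in\mathbb{N}_0,\ x\in\mathfrak{X}_\ell\}\in\mathbb{N}\cup\{\infty\}$ (with $\inf\emptyset=\infty$). Random bit Monte Carlo algorithms. Let $\Omega=\{0,1\}^{\mathbb{N}}$ with the product $\sigma$-algebra and $P$ the product of uniform distributions on $\{0,1\}$. A random bit Monte Carlo algorithm is a tuple $\widehat{\mathcal{S}}=((\psi_\ell)_{\ell\ge1},(\tau_\ell)_{\ell\ge1},(\phi_\ell)_{\ell\ge1})$ of arbitrary mappings $\psi_\ell:\{0,1\}^\ell\times\mathbb{R}^{\ell-1}\to\mathfrak{X}$, $\tau_\ell:\{0,1\}^\ell\times\mathbb{R}^\ell\to\{0,1\}$, $\phi_\ell:\{0,1\}^\ell\times\mathbb{R}^\ell\to\mathbb{R}$ (with $\psi_1:\{0,1\}\to\mathfrak{X}$).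 For $\omega\in\Omega$ and $f\in F$ put $y_1=f(\psi_1(\omega_1))$, $y_\ell=f(\psi_\ell(\omega_1,\dots,\omega_\ell,y_1,\dots,y_{\ell-1}))$ for $\ell\ge2$, and $n(\omega,f)=\min\{\ell\in\mathbb{N}:\tau_\ell(\omega_1,\dots,\omega_\ell,y_1,\dots,y_\ell)=1\}\in\mathbb{N}\cup\{\infty\}$. It is required that $P(\{n(\cdot,f)<\infty\})=1$ for every $f\in F$. The output is $\widehat S(\omega,f)=\phi_{n(\omega,f)}(\omega_1,\dots,\omega_{n(\omega,f)},y_1,\dots,y_{n(\omega,f)})$ if $n(\omega,f)<\infty$ and $\widehat S(\omega,f)=0$ otherwise. The class of all such algorithms is $\mathbb{S}^{\mathrm{bit}}$. Cost, error, complexity. $\mathrm{cost}_{\mathfrak{c}}(\widehat{\mathcal{S}},f)=\mathrm{E}\bigl(\sum_{\ell=1}^{n(\cdot,f)}\mathfrak{c}(\psi_\ell(\omega_1,\dots,\omega_\ell,y_1,\dots,y_{\ell-1}))\bigr)$, $\mathrm{e}(\widehat{\mathcal{S}},f)=(\mathrm{E}|S(f)-\widehat S(\cdot,f)|^2)^{1/2}$, $\mathrm{cost}_{\mathfrak{c}}(\widehat{\mathcal{S}})=\sup_{f\in F}\mathrm{cost}_{\mathfrak{c}}(\widehat{\mathcal{S}},f)$, $\mathrm{e}(\widehat{\mathcal{S}})=\sup_{f\in F}\mathrm{e}(\widehat{\mathcal{S}},f)$, and \[\mathrm{comp}^{\mathrm{bit}}_{\mathfrak{c}}(\varepsilon)=\inf\{\mathrm{cost}_{\mathfrak{c}}(\widehat{\mathcal{S}}):\widehat{\mathcal{S}}\in\mathbb{S}^{\mathrm{bit}},\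 \mathrm{e}(\widehat{\mathcal{S}})\le\varepsilon\},\qquad \varepsilon>0.\] *)

theory Defs
  imports "HOL-Probability.Probability"
begin

section \<open>Regularity of coefficients\<close>

definition has_partial_derivative ::
    "(real^'n \<Rightarrow> real) \<Rightarrow> 'n \<Rightarrow> real \<Rightarrow> real^'n \<Rightarrow> bool" where
  "has_partial_derivative g i D x \<longleftrightarrow>
     ((\<lambda>h. g (x + h *\<^sub>R axis i 1)) has_real_derivative D) (at 0)"

definition bounded_partials_upto2 :: "(real^'n \<Rightarrow> real) \<Rightarrow> bool" where
  "bounded_partials_upto2 g \<longleftrightarrow>
     (\<exists>g' g'' C.
        (\<forall>i x. has_partial_derivative g i (g' i x) x \<and> \<bar>g' i x\<bar> \<le> C) \<and>
        (\<forall>i j x. has_partial_derivative (g' i) j (g'' i j x) x \<and> \<bar>g'' i j x\<bar> \<le> C))"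

primrec Ck_on :: "nat \<Rightarrow> (real^'n) set \<Rightarrow> (real^'n \<Rightarrow> real) \<Rightarrow> bool" where
  "Ck_on 0 U g \<longleftrightarrow> continuous_on U g"
| "Ck_on (Suc k) U g \<longleftrightarrow> continuous_on U g \<and>
     (\<exists>g'. \<forall>i. (\<forall>x\<in>U. has_partial_derivative g i (g' i x) x) \<and> Ck_on k U (g' i))"

definition Cinfinity_on :: "(real^'n) set \<Rightarrow> (real^'n \<Rightarrow> real) \<Rightarrow> bool" where
  "Cinfinity_on U g \<longleftrightarrow> (\<forall>k. Ck_on k U g)"


section \<open>Stochastic differential equations\<close>

text \<open>
  The filtration is indexed by \<^typ>\<open>real\<close>; only times in \<open>[0, \<infinity>)\<close> are used.  It is not
  required to be complete or right-continuous.
\<close>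

definition brownian_motion ::
    "'a measure \<Rightarrow> (real \<Rightarrow> 'a measure) \<Rightarrow> (real \<Rightarrow> 'a \<Rightarrow> real^'d) \<Rightarrow> bool" where
  "brownian_motion M F W \<longleftrightarrow>
     prob_space M \<and> filtration (space M) F \<and> (\<forall>t. subalgebra M (F t)) \<and>
     (\<forall>t\<ge>0. W t \<in> borel_measurable (F t)) \<and>
     (AE \<omega> in M. W 0 \<omega> = 0) \<and>
     (AE \<omega> in M. continuous_on {0..} (\<lambda>t. W t \<omega>)) \<and>
     (\<forall>s\<ge>0. \<forall>t>s.
        prob_space.indep_set M (sets (F s))
          {(\<lambda>\<omega>. W t \<omega> - W s \<omega>) -` B \<inter> space M |B. B \<in> sets borel} \<and>
        distributed M lborel (\<lambda>\<omega>. W t \<omega> - W s \<omega>)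
          (\<lambda>x. ennreal (\<Prod>i\<in>UNIV. normal_density 0 (sqrt (t - s)) (x $ i))))"

text \<open>
  A simple integrand \<open>\<Sum>k<n. \<xi> k \<cdot> 1(\<tau> k, \<tau> (k+1)]\<close> with deterministic times \<open>\<tau>\<close> and bounded,
  nonanticipating matrix-valued coefficients \<open>\<xi>\<close>.
\<close>

definition simple_integrand ::
    "'a measure \<Rightarrow> (real \<Rightarrow> 'a measure) \<Rightarrow> nat \<Rightarrow> (nat \<Rightarrow> real) \<Rightarrow> (nat \<Rightarrow> 'a \<Rightarrow> real^'d^'r) \<Rightarrow> bool"
  where
  "simple_integrand M F n \<tau> \<xi> \<longleftrightarrow>
     0 \<le> \<tau> 0 \<and> (\<forall>k<n. \<tau> k < \<tau> (Suc k)) \<and>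
     (\<forall>k<n. \<xi> k \<in> borel_measurable (F (\<tau> k)) \<and> bounded (\<xi> k ` space M))"

definition simple_process ::
    "nat \<Rightarrow> (nat \<Rightarrow> real) \<Rightarrow> (nat \<Rightarrow> 'a \<Rightarrow> real^'d^'r) \<Rightarrow> real \<Rightarrow> 'a \<Rightarrow> real^'d^'r" where
  "simple_process n \<tau> \<xi> s \<omega> = (\<Sum>k<n. indicator {\<tau> k<..\<tau> (Suc k)} s *\<^sub>R \<xi> k \<omega>)"

definition simple_integral ::
    "(real \<Rightarrow> 'a \<Rightarrow> real^'d) \<Rightarrow> nat \<Rightarrow> (nat \<Rightarrow> real) \<Rightarrow> (nat \<Rightarrow> 'a \<Rightarrow> real^'d^'r) \<Rightarrow> real \<Rightarrow> 'a \<Rightarrow> real^'r"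
  where
  "simple_integral W n \<tau> \<xi> t \<omega> =
     (\<Sum>k<n. \<xi> k \<omega> *v (W (min t (\<tau> (Suc k))) \<omega> - W (min t (\<tau> k)) \<omega>))"

definition progressively_measurable_upto ::
    "(real \<Rightarrow> 'a measure) \<Rightarrow> real \<Rightarrow> (real \<Rightarrow> 'a \<Rightarrow> 'b::topological_space) \<Rightarrow> bool" where
  "progressively_measurable_upto F T H \<longleftrightarrow>
     (\<forall>t\<in>{0..T}. (\<lambda>(s, \<omega>). H s \<omega>)
        \<in> borel_measurable (restrict_space borel {0..t} \<Otimes>\<^sub>M F t))"

text \<open>
  \<open>has_ito_integral M F W H T I\<close>: the random variable \<open>I\<close> is (a version of) the Ito integral of
  \<open>H\<close> with respect to \<open>W\<close> over \<open>[0, T]\<close>, for \<open>H\<close> progressively measurable with almost surely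
  square integrable paths.  As usual it is the limit in probability of the integrals of simple
  integrands that converge to \<open>H\<close> in \<open>L\<^sup>2([0, T])\<close> in probability.  The norm on
  \<^typ>\<open>real^'d^'r\<close> is the Frobenius norm.
\<close>

definition has_ito_integral ::
    "'a measure \<Rightarrow> (real \<Rightarrow> 'a measure) \<Rightarrow> (real \<Rightarrow> 'a \<Rightarrow> real^'d) \<Rightarrow>
     (real \<Rightarrow> 'a \<Rightarrow> real^'d^'r) \<Rightarrow> real \<Rightarrow> ('a \<Rightarrow> real^'r) \<Rightarrow> bool" where
  "has_ito_integral M F W H T I \<longleftrightarrow>
     progressively_measurable_upto F T H \<and>
     (AE \<omega> in M. (\<integral>\<^sup>+ s\<in>{0..T}. ennreal ((norm (H s \<omega>))\<^sup>2) \<partial>lborel) < \<infinity>) \<and>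
     I \<in> borel_measurable M \<and>
     (\<exists>n \<tau> \<xi>.
        (\<forall>m. simple_integrand M F (n m) (\<tau> m) (\<xi> m)) \<and>
        (\<forall>e>0. (\<lambda>m. measure M {\<omega>\<in>space M. ennreal e <
             (\<integral>\<^sup>+ s\<in>{0..T}. ennreal ((norm (simple_process (n m) (\<tau> m) (\<xi> m) s \<omega> - H s \<omega>))\<^sup>2) \<partial>lborel)})
           \<longlonglongrightarrow> 0) \<and>
        (\<forall>e>0. (\<lambda>m. measure M {\<omega>\<in>space M.
             e < dist (simple_integral W (n m) (\<tau> m) (\<xi> m) T \<omega>) (I \<omega>)})
           \<longlonglongrightarrow> 0))"

text \<open>
  All paths of the solution (not only almost all) are continuous on \<open>[0, 1]\<close>, so that the solution
  is a random element of the path space.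
\<close>

definition sde_solution ::
    "(real^'r \<Rightarrow> real^'r) \<Rightarrow> (real^'r \<Rightarrow> real^'d^'r) \<Rightarrow> real^'r \<Rightarrow>
     'a measure \<Rightarrow> (real \<Rightarrow> 'a measure) \<Rightarrow> (real \<Rightarrow> 'a \<Rightarrow> real^'d) \<Rightarrow> (real \<Rightarrow> 'a \<Rightarrow> real^'r) \<Rightarrow> bool"
  where
  "sde_solution a b x0 M F W X \<longleftrightarrow>
     brownian_motion M F W \<and>
     (\<forall>t\<in>{0..1}. X t \<in> borel_measurable (F t)) \<and>
     (\<forall>\<omega>\<in>space M. continuous_on {0..1} (\<lambda>t. X t \<omega>)) \<and>
     (AE \<omega> in M. X 0 \<omega> = x0) \<and>
     (\<forall>t\<in>{0..1}. \<exists>I. has_ito_integral M F W (\<lambda>s \<omega>. b (X s \<omega>)) t I \<and>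
        (AE \<omega> in M. X t \<omega> = x0 + integral {0..t} (\<lambda>s. a (X s \<omega>)) + I \<omega>))"


section \<open>Path space, Lipschitz functionals, and cost of a node\<close>

text \<open>
  \<open>C([0,1], \<real>\<^sup>r)\<close> with the supremum metric; its elements are functions on \<^typ>\<open>real\<close>
  that are \<^const>\<open>undefined\<close> outside \<open>[0, 1]\<close>.
\<close>

definition path_space :: "(real \<Rightarrow> real^'r) metric" where
  "path_space = cfunspace (top_of_set {0..1}) euclidean_metric"

lemma mspace_path_space:
  "mspace path_space = {x \<in> extensional {0..1}. continuous_on {0..1} x}"
proof -
  have "bounded (x ` {0..1})" if "continuous_on {0..1} x" for x :: "real \<Rightarrow> real^'r"
    using that by (intro compact_imp_bounded compact_continuous_image) auto
  then show ?thesis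
    by (auto simp: path_space_def Met_TC.fspace_def)
qed

lemma mdist_path_space:
  assumes "x \<in> mspace path_space" "y \<in> mspace path_space"
  shows "mdist path_space x y = (SUP t\<in>{0..1}. norm (x t - y t))"
  using assms
  by (auto simp: path_space_def mdist_cfunspace_eq_mdist_funspace Met_TC.fspace_def
      Met_TC.fdist_def dist_norm)

definition Lip1 :: "((real \<Rightarrow> real^'r) \<Rightarrow> real) set" where
  "Lip1 = {f. \<forall>x\<in>mspace path_space. \<forall>y\<in>mspace path_space. \<bar>f x - f y\<bar> \<le> mdist path_space x y}"

definition piecewise_linear_paths :: "nat \<Rightarrow> (real \<Rightarrow> real^'r) set" where
  "piecewise_linear_paths l = {x \<in> mspace path_space.
     \<forall>k<2 ^ l. \<exists>u v. \<forall>t\<in>{real k / 2 ^ l..real (Suc k) / 2 ^ l}. x t = u + t *\<^sub>R v}"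

definition node_cost :: "(real \<Rightarrow> real^'r) \<Rightarrow> ennreal" where
  "node_cost x = (INF l\<in>{l. x \<in> piecewise_linear_paths l}. 2 ^ l + 1)"

definition sde_functional ::
    "'a measure \<Rightarrow> (real \<Rightarrow> 'a \<Rightarrow> real^'r) \<Rightarrow> ((real \<Rightarrow> real^'r) \<Rightarrow> real) \<Rightarrow> real" where
  "sde_functional M X f = (\<integral>\<omega>. f (restrict (\<lambda>t. X t \<omega>) {0..1}) \<partial>M)"


section \<open>Random bit Monte Carlo algorithms\<close>

text \<open>
  Bits are booleans (1 is \<^const>\<open>True\<close>), and \<open>\<omega> i\<close> is the bit number \<open>i + 1\<close>.  Finite
  tuples of bits or function values are lists; the component functions for step \<open>l \<ge> 1\<close> are only
  ever applied to bit lists of length \<open>l\<close> and value lists of length \<open>l - 1\<close> (nodes) or \<open>l\<close>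
  (stopping rule and output), so their values elsewhere are irrelevant.
\<close>

definition bit_space :: "(nat \<Rightarrow> bool) measure" where
  "bit_space = Pi\<^sub>M UNIV (\<lambda>_. measure_pmf (pmf_of_set UNIV))"

record 'p bit_algorithm =
  node_map :: "nat \<Rightarrow> bool list \<Rightarrow> real list \<Rightarrow> 'p"
  stop_map :: "nat \<Rightarrow> bool list \<Rightarrow> real list \<Rightarrow> bool"
  out_map :: "nat \<Rightarrow> bool list \<Rightarrow> real list \<Rightarrow> real"

definition first_bits :: "(nat \<Rightarrow> bool) \<Rightarrow> nat \<Rightarrow> bool list" where
  "first_bits \<omega> l = map \<omega> [0..<l]"

primrec observed_values ::
    "'p bit_algorithm \<Rightarrow> (nat \<Rightarrow> bool) \<Rightarrow> ('p \<Rightarrow> real) \<Rightarrow> nat \<Rightarrow> real list" where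
  "observed_values A \<omega> f 0 = []"
| "observed_values A \<omega> f (Suc l) =
     observed_values A \<omega> f l @
     [f (node_map A (Suc l) (first_bits \<omega> (Suc l)) (observed_values A \<omega> f l))]"

definition node_at :: "'p bit_algorithm \<Rightarrow> (nat \<Rightarrow> bool) \<Rightarrow> ('p \<Rightarrow> real) \<Rightarrow> nat \<Rightarrow> 'p" where
  "node_at A \<omega> f l = node_map A l (first_bits \<omega> l) (observed_values A \<omega> f (l - 1))"

definition num_steps :: "'p bit_algorithm \<Rightarrow> (nat \<Rightarrow> bool) \<Rightarrow> ('p \<Rightarrow> real) \<Rightarrow> enat" where
  "num_steps A \<omega> f =
     (INF l\<in>{l. 1 \<le> l \<and> stop_map A l (first_bits \<omega> l) (observed_values A \<omega> f l)}. enat l)"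

definition alg_output :: "'p bit_algorithm \<Rightarrow> (nat \<Rightarrow> bool) \<Rightarrow> ('p \<Rightarrow> real) \<Rightarrow> real" where
  "alg_output A \<omega> f =
     (case num_steps A \<omega> f of
        enat l \<Rightarrow> out_map A l (first_bits \<omega> l) (observed_values A \<omega> f l)
      | \<infinity> \<Rightarrow> 0)"

definition bit_algorithms :: "(real \<Rightarrow> real^'r) bit_algorithm set" where
  "bit_algorithms = {A.
     (\<forall>l\<ge>1. \<forall>u y. length u = l \<longrightarrow> length y = l - 1 \<longrightarrow> node_map A l u y \<in> mspace path_space) \<and>
     (\<forall>f\<in>Lip1. AE \<omega> in bit_space. num_steps A \<omega> f < \<infinity>)}"

definition cost_at ::
    "(real \<Rightarrow> real^'r) bit_algorithm \<Rightarrow> ((real \<Rightarrow> real^'r) \<Rightarrow> real) \<Rightarrow> ennreal" where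
  "cost_at A f =
     (\<integral>\<^sup>+ \<omega>. (\<Sum>l. if 1 \<le> l \<and> enat l \<le> num_steps A \<omega> f then node_cost (node_at A \<omega> f l) else 0)
        \<partial>bit_space)"

definition alg_cost :: "(real \<Rightarrow> real^'r) bit_algorithm \<Rightarrow> ennreal" where
  "alg_cost A = (SUP f\<in>Lip1. cost_at A f)"

definition ennreal_sqrt :: "ennreal \<Rightarrow> ennreal" where
  "ennreal_sqrt v = (if v = \<infinity> then \<infinity> else ennreal (sqrt (enn2real v)))"

definition error_at ::
    "(((real \<Rightarrow> real^'r) \<Rightarrow> real) \<Rightarrow> real) \<Rightarrow> (real \<Rightarrow> real^'r) bit_algorithm \<Rightarrow>
     ((real \<Rightarrow> real^'r) \<Rightarrow> real) \<Rightarrow> ennreal" where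
  "error_at S A f =
     ennreal_sqrt (\<integral>\<^sup>+ \<omega>. ennreal (\<bar>S f - alg_output A \<omega> f\<bar>\<^sup>2) \<partial>bit_space)"

definition alg_error ::
    "(((real \<Rightarrow> real^'r) \<Rightarrow> real) \<Rightarrow> real) \<Rightarrow> (real \<Rightarrow> real^'r) bit_algorithm \<Rightarrow> ennreal" where
  "alg_error S A = (SUP f\<in>Lip1. error_at S A f)"

definition comp_bit :: "(((real \<Rightarrow> real^'r) \<Rightarrow> real) \<Rightarrow> real) \<Rightarrow> real \<Rightarrow> ennreal" where
  "comp_bit S \<epsilon> = (INF A\<in>{A \<in> bit_algorithms. alg_error S A \<le> ennreal \<epsilon>}. alg_cost A)"

end

theory Submission
  imports Defs
begin

text \<open>
  The bound comes from one functional for each scale \<open>h = 2\<^sup>-\<^sup>L\<close>, namely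
  \<open>f x = min (sqrt h) (\<bar>x 0 - 2 x (h/2) + x h\<bar> / 4)\<close>.  It is Lipschitz with constant 1, and it
  vanishes at every path that is linear on \<open>[0, h]\<close>, hence at every node of cost at most
  \<open>2\<^sup>L + 1\<close>.  An algorithm whose expected cost for the zero functional is at most \<open>2\<^sup>L\<close> uses
  only such nodes with probability at least 1/2, by Markov's inequality and because the next
  possible cost is \<open>2\<^sup>L\<^sup>+\<^sup>1 + 1\<close>.  On that event it observes only zeros for each of
  \<open>f\<close>, \<open>-f\<close> and \<open>0\<close>, and therefore returns the same number for \<open>f\<close> and \<open>-f\<close>, although the correct
  values are \<open>S f\<close> and \<open>- S f\<close>.  So its error is at least \<open>S f / 2\<close> (\<open>alg_error_ge\<close>).

  If \<open>S f \<ge> c (sqrt h)\<close> for all small \<open>h\<close>, then error at most \<open>\<epsilon>\<close> forces the cost above \<open>2\<^sup>L\<close>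
  for every \<open>L\<close> such that \<open>\<epsilon>\<close> is smaller than \<open>c / 2\<close> times the square root of \<open>2\<^sup>-\<^sup>L\<close>.  The
  largest such \<open>L\<close> makes \<open>2\<^sup>L\<close> a constant multiple of \<open>\<epsilon>\<^sup>-\<^sup>2\<close>, up to a factor 2
  (\<open>comp_bit_lower_bound\<close>).

  It remains to see that the second difference of the solution \<open>X\<close> over \<open>[0, h]\<close> exceeds a constant
  times \<open>sqrt h\<close> with a probability that does not depend on \<open>h\<close>
  (\<open>second_difference_lower_bound\<close>).  To leading order \<open>X t = x0 + b x0 W t\<close>: the drift over
  \<open>[0, h]\<close> is of order \<open>h\<close>, and the Ito integral of \<open>b (X s) - b x0\<close> is small compared with
  \<open>sqrt h\<close>, because its integrand is small as long as \<open>X\<close> stays near \<open>x0\<close>.  The second difference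
  of \<open>b x0 W\<close> has the right size since \<open>b x0\<close> is invertible and two consecutive independent
  Gaussian increments have opposite signs, and typical sizes, with positive probability.

  Because \<open>f\<close> is truncated at \<open>sqrt h\<close>, all of this is needed in probability only: no moments of
  \<open>X\<close> enter.  The estimate of the Ito integral is accordingly one in probability, of Lenglart type
  (\<open>step_sum_deviation\<close>, \<open>ito_integral_deviation\<close>): for step integrands one switches the integrand
  off before its accumulated square exceeds a level \<open>\<kappa>\<close>, applies the isometry bound and
  Chebyshev's inequality, and passes to the limit in the definition of the integral.
\<close>

section \<open>Gaussian increments of Brownian motion\<close>

lemma prod_Basis_vec: "(\<Prod>b\<in>Basis. g b) = (\<Prod>i\<in>UNIV. g (axis i (1::real)))"
  for g :: "real^'n \<Rightarrow> 'b::comm_monoid_mult"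
proof -
  have "Basis = range (\<lambda>i. axis i 1 :: real^'n)"
    by (auto simp: Basis_vec_def)
  then show ?thesis
    by (metis (no_types, lifting) prod.reindex_cong inj_onI axis_eq_axis zero_neq_one)
qed

lemma borel_measurable_vec_component [measurable (raw)]:
  "f \<in> borel_measurable M \<Longrightarrow> (\<lambda>x. (f x :: real^'n) $ i) \<in> borel_measurable M"
  by (rule measurable_compose[of f M borel])
    (auto intro!: borel_measurable_continuous_onI linear_continuous_on bounded_linear_vec_nth)

text \<open>
  With the components of a Gaussian vector reduced to one-dimensional normal variables, the known
  moments of the normal distribution apply.  The density is a product, so the integral of the
  indicator of a cylinder set factorizes and all factors but one are 1.
\<close>

lemma distributed_normal_component:
  fixes X :: "'a \<Rightarrow> real^'n"
  assumes D: "distributed M lborel X (\<lambda>x. ennreal (\<Prod>i\<in>UNIV. normal_density 0 \<sigma> (x $ i)))"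
    and \<sigma>: "0 < \<sigma>"
  shows "distributed M lborel (\<lambda>\<omega>. X \<omega> $ i) (normal_density 0 \<sigma>)"
proof -
  have X[measurable]: "X \<in> borel_measurable M"
    using D by (simp add: distributed_def)
  have "distr M lborel (\<lambda>\<omega>. X \<omega> $ i) = density lborel (normal_density 0 \<sigma>)"
  proof (rule measure_eqI)
    fix A assume "A \<in> sets (distr M lborel (\<lambda>\<omega>. X \<omega> $ i))"
    then have A[measurable]: "A \<in> sets borel" by simp
    have [measurable]: "{x::real^'n. x $ i \<in> A} \<in> sets borel"
      by measurable
    let ?f = "\<lambda>b t. ennreal (normal_density 0 \<sigma> t) *
                (if b = axis i (1::real) then indicator A t else (1::ennreal))"
    have total: "(\<integral>\<^sup>+t. ennreal (normal_density 0 \<sigma> t) \<partial>lborel) = 1"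
      using \<sigma> by (subst nn_integral_eq_integral) auto
    have "emeasure (distr M lborel (\<lambda>\<omega>. X \<omega> $ i)) A
        = emeasure M (X -` {x. x $ i \<in> A} \<inter> space M)"
      by (subst emeasure_distr) (auto simp: vimage_def)
    also have "\<dots> = (\<integral>\<^sup>+x. ennreal (\<Prod>j\<in>UNIV. normal_density 0 \<sigma> (x $ j)) *
        indicator {x. x $ i \<in> A} x \<partial>lborel)"
      by (subst distributed_emeasure[OF D]) auto
    also have "\<dots> = (\<integral>\<^sup>+x. (\<Prod>b\<in>Basis. ?f b (x \<bullet> b)) \<partial>(lborel :: (real^'n) measure))"
    proof (rule nn_integral_cong)
      fix x :: "real^'n"
      have "(\<Prod>b\<in>Basis. ?f b (x \<bullet> b)) =
          (\<Prod>j\<in>UNIV. ennreal (normal_density 0 \<sigma> (x $ j)) * (if j = i then indicator A (x $ j) else 1))"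
        by (auto simp: prod_Basis_vec inner_axis axis_eq_axis intro!: prod.cong)
      then show "ennreal (\<Prod>j\<in>UNIV. normal_density 0 \<sigma> (x $ j)) * indicator {x. x $ i \<in> A} x
          = (\<Prod>b\<in>Basis. ?f b (x \<bullet> b))"
        by (simp add: prod.distrib prod_ennreal indicator_def)
    qed
    also have "\<dots> = (\<Prod>b\<in>Basis. \<integral>\<^sup>+t. ?f b t \<partial>lborel)"
      by (rule nn_integral_lborel_prod) auto
    also have "\<dots> = (\<Prod>j\<in>UNIV. if j = i
        then \<integral>\<^sup>+t. ennreal (normal_density 0 \<sigma> t) * indicator A t \<partial>lborel else 1)"
      by (subst prod_Basis_vec, rule prod.cong) (auto simp: axis_eq_axis total)
    also have "\<dots> = emeasure (density lborel (normal_density 0 \<sigma>)) A"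
      by (simp add: emeasure_density)
    finally show "emeasure (distr M lborel (\<lambda>\<omega>. X \<omega> $ i)) A
        = emeasure (density lborel (normal_density 0 \<sigma>)) A" .
  qed simp
  then show ?thesis
    by (simp add: distributed_def)
qed

text \<open>
  On these intervals of length \<open>\<sigma>\<close> the density is at least \<open>exp (-2) / (sqrt (2 pi) \<sigma>)\<close>.  What
  matters is that the resulting bound is the same for all \<open>\<sigma>\<close>.
\<close>

lemma normal_interval_prob:
  assumes D: "distributed M lborel Y (normal_density 0 \<sigma>)" and \<sigma>: "0 < \<sigma>"
    and I: "I = {\<sigma>..2*\<sigma>} \<or> I = {-2*\<sigma>..-\<sigma>}"
  shows "ennreal (exp (-2) / sqrt (2 * pi)) \<le> emeasure M (Y -` I \<inter> space M)"
proof -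
  have [measurable]: "I \<in> sets borel" using I by auto
  have len: "emeasure lborel I = ennreal \<sigma>" using I \<sigma> by auto
  have lb: "exp (-2) / sqrt (2 * pi) / \<sigma> \<le> normal_density 0 \<sigma> t" if "t \<in> I" for t
  proof -
    have "\<bar>t\<bar> \<le> \<bar>2 * \<sigma>\<bar>" using that I \<sigma> by auto
    then have "t\<^sup>2 \<le> (2 * \<sigma>)\<^sup>2" using abs_le_square_iff by blast
    then have "-2 \<le> - t\<^sup>2 / (2 * \<sigma>\<^sup>2)" using \<sigma> by (simp add: divide_simps power2_eq_square)
    then show ?thesis
      using \<sigma> by (simp add: normal_density_def real_sqrt_mult divide_simps)
  qed
  have "ennreal (exp (-2) / sqrt (2 * pi)) = ennreal (exp (-2) / sqrt (2 * pi) / \<sigma>) * emeasure lborel I"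
    using \<sigma> by (simp add: len flip: ennreal_mult)
  also have "\<dots> = (\<integral>\<^sup>+t. ennreal (exp (-2) / sqrt (2 * pi) / \<sigma>) * indicator I t \<partial>lborel)"
    by (rule nn_integral_cmult_indicator[symmetric]) simp
  also have "\<dots> \<le> (\<integral>\<^sup>+t. ennreal (normal_density 0 \<sigma> t) * indicator I t \<partial>lborel)"
    using lb by (intro nn_integral_mono) (auto simp: indicator_def ennreal_leI)
  also have "\<dots> = emeasure M (Y -` I \<inter> space M)"
    by (simp add: distributed_emeasure[OF D])
  finally show ?thesis .
qed

locale brownian = prob_space M
  for M :: "'a measure" and F :: "real \<Rightarrow> 'a measure" and W :: "real \<Rightarrow> 'a \<Rightarrow> real^'d" +
  assumes brownian: "brownian_motion M F W"
begin

lemma filtration_F: "filtration (space M) F"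
  and subalgebra_F: "subalgebra M (F t)"
  and W_adapted': "\<forall>t\<ge>0. W t \<in> borel_measurable (F t)"
  using brownian unfolding brownian_motion_def by simp_all

lemma space_F: "space (F s) = space M"
  by (rule filtration.space_F[OF filtration_F])

lemma measurable_le: "f \<in> measurable (F s) N \<Longrightarrow> s \<le> t \<Longrightarrow> f \<in> measurable (F t) N"
  using filtration.sets_F_mono[OF filtration_F, of s t]
  by (intro measurable_from_subalg[of "F t" "F s"]) (simp_all add: subalgebra_def space_F)

lemma measurable_F: "f \<in> measurable (F s) N \<Longrightarrow> f \<in> measurable M N"
  by (rule measurable_from_subalg[OF subalgebra_F])

lemma W_adapted: "0 \<le> s \<Longrightarrow> s \<le> t \<Longrightarrow> W s \<in> borel_measurable (F t)"
  using W_adapted' measurable_le by blast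

lemma W_measurable[measurable]: "0 \<le> s \<Longrightarrow> W s \<in> borel_measurable M"
  using W_adapted[of s s] measurable_F by blast

lemma increment:
  assumes "0 \<le> s" "s < t"
  shows "indep_set (sets (F s)) {(\<lambda>\<omega>. W t \<omega> - W s \<omega>) -` B \<inter> space M |B. B \<in> sets borel}"
    and "distributed M lborel (\<lambda>\<omega>. W t \<omega> - W s \<omega>)
          (\<lambda>x. ennreal (\<Prod>i\<in>UNIV. normal_density 0 (sqrt (t - s)) (x $ i)))"
proof -
  have "\<forall>s\<ge>0. \<forall>t>s.
      indep_set (sets (F s)) {(\<lambda>\<omega>. W t \<omega> - W s \<omega>) -` B \<inter> space M |B. B \<in> sets borel} \<and>
      distributed M lborel (\<lambda>\<omega>. W t \<omega> - W s \<omega>)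
        (\<lambda>x. ennreal (\<Prod>i\<in>UNIV. normal_density 0 (sqrt (t - s)) (x $ i)))"
    using brownian unfolding brownian_motion_def by (elim conjE)
  note this[rule_format, OF assms]
  then show "indep_set (sets (F s)) {(\<lambda>\<omega>. W t \<omega> - W s \<omega>) -` B \<inter> space M |B. B \<in> sets borel}"
    and "distributed M lborel (\<lambda>\<omega>. W t \<omega> - W s \<omega>)
          (\<lambda>x. ennreal (\<Prod>i\<in>UNIV. normal_density 0 (sqrt (t - s)) (x $ i)))"
    by (rule conjunct1, rule conjunct2)
qed

lemma increment_normal:
  assumes "0 \<le> s" "s < t"
  shows "distributed M lborel (\<lambda>\<omega>. (W t \<omega> - W s \<omega>) $ i) (normal_density 0 (sqrt (t - s)))"
  by (rule distributed_normal_component[OF increment(2)[OF assms]]) (use assms in simp)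

lemma increment_indep_event:
  assumes "0 \<le> s" "s < t" "A \<in> sets (F s)" "B \<in> sets borel"
  shows "prob (A \<inter> ((\<lambda>\<omega>. W t \<omega> - W s \<omega>) -` B \<inter> space M))
    = prob A * prob ((\<lambda>\<omega>. W t \<omega> - W s \<omega>) -` B \<inter> space M)"
  by (rule indep_setD[OF increment(1)]) (use assms in blast)+

lemma increment_indep:
  fixes Y :: "'a \<Rightarrow> 'z::topological_space"
  assumes st: "0 \<le> s" "s < t" and Y: "Y \<in> borel_measurable (F s)"
    and g[measurable]: "g \<in> borel_measurable borel"
  shows "indep_var borel Y borel (\<lambda>\<omega>. g (W t \<omega> - W s \<omega>))"
proof -
  let ?D = "\<lambda>\<omega>. W t \<omega> - W s \<omega>"
  have [measurable]: "Y \<in> borel_measurable M" "?D \<in> borel_measurable M"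
    using measurable_F[OF Y] st by auto
  have "indep_set {Y -` A \<inter> space M |A. A \<in> sets borel} {(\<lambda>\<omega>. g (?D \<omega>)) -` A \<inter> space M |A. A \<in> sets borel}"
  proof (rule indep_setI)
    fix A' B' assume "A' \<in> {Y -` A \<inter> space M |A. A \<in> sets borel}"
      and "B' \<in> {(\<lambda>\<omega>. g (?D \<omega>)) -` A \<inter> space M |A. A \<in> sets borel}"
    then obtain A B where A: "A' = Y -` A \<inter> space M" "A \<in> sets borel"
      and B: "B' = ?D -` (g -` B) \<inter> space M" "B \<in> sets borel" by blast
    have "A' \<in> sets (F s)"
      using A measurable_sets[OF Y, of A] by (simp add: space_F)
    moreover have "g -` B \<in> sets borel"
      using measurable_sets[OF g B(2)] by simp
    ultimately show "prob (A' \<inter> B') = prob A' * prob B'"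
      using increment_indep_event[OF st, of A' "g -` B"] B by simp
  qed auto
  moreover have "Int_stable {Z -` A \<inter> space M |A. A \<in> sets borel}" for Z :: "'a \<Rightarrow> 'z"
  proof (rule Int_stableI)
    fix a b assume "a \<in> {Z -` A \<inter> space M |A. A \<in> sets borel}" "b \<in> {Z -` A \<inter> space M |A. A \<in> sets borel}"
    then obtain A B where "a = Z -` A \<inter> space M" "A \<in> sets borel" "b = Z -` B \<inter> space M" "B \<in> sets borel"
      by blast
    then have "a \<inter> b = Z -` (A \<inter> B) \<inter> space M" "A \<inter> B \<in> sets borel"
      by auto
    then show "a \<inter> b \<in> {Z -` A \<inter> space M |A. A \<in> sets borel}" by blast
  qed
  ultimately show ?thesis
    unfolding indep_var_eq by (intro conjI indep_set_sigma_sets) auto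
qed

lemma increment_moments:
  assumes st: "0 \<le> s" "s < t"
  shows "integrable M (\<lambda>\<omega>. (W t \<omega> - W s \<omega>) $ i)"
    and "expectation (\<lambda>\<omega>. (W t \<omega> - W s \<omega>) $ i) = 0"
    and "integrable M (\<lambda>\<omega>. ((W t \<omega> - W s \<omega>) $ i)\<^sup>2)"
    and "expectation (\<lambda>\<omega>. ((W t \<omega> - W s \<omega>) $ i)\<^sup>2) = t - s"
proof -
  let ?D = "\<lambda>\<omega>. (W t \<omega> - W s \<omega>) $ i" and ?\<sigma> = "sqrt (t - s)"
  have \<sigma>: "0 < ?\<sigma>" using st by simp
  note D = increment_normal[OF st, of i]
  show "integrable M ?D"
    by (rule distributed_integrable_var[OF D]) (auto intro: integrable_normal_moment_nz_1 \<sigma>)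
  show E0: "expectation ?D = 0"
    by (rule normal_distributed_expectation[OF \<sigma> D])
  show "integrable M (\<lambda>\<omega>. (?D \<omega>)\<^sup>2)"
    using distributed_integrable[OF D, of "\<lambda>x. x\<^sup>2"] integrable_normal_moment[OF \<sigma>, of 0 2] by auto
  show "expectation (\<lambda>\<omega>. (?D \<omega>)\<^sup>2) = t - s"
    using normal_distributed_variance[OF \<sigma> D] E0 st by simp
qed

lemma increment_norm_moment:
  assumes st: "0 \<le> s" "s < t"
  shows "integrable M (\<lambda>\<omega>. (norm (W t \<omega> - W s \<omega>))\<^sup>2)"
    and "expectation (\<lambda>\<omega>. (norm (W t \<omega> - W s \<omega>))\<^sup>2) = real CARD('d) * (t - s)"
proof -
  have eq: "(norm x)\<^sup>2 = (\<Sum>i\<in>UNIV. (x $ i)\<^sup>2)" for x :: "real^'d"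
    by (simp add: norm_vec_def L2_set_def sum_nonneg)
  show "integrable M (\<lambda>\<omega>. (norm (W t \<omega> - W s \<omega>))\<^sup>2)"
    unfolding eq by (intro Bochner_Integration.integrable_sum increment_moments[OF st])
  show "expectation (\<lambda>\<omega>. (norm (W t \<omega> - W s \<omega>))\<^sup>2) = real CARD('d) * (t - s)"
    unfolding eq by (subst Bochner_Integration.integral_sum)
      (simp_all only: increment_moments[OF st], simp)
qed

end

section \<open>Step integrands: orthogonality and deviation in probability\<close>

lemma steps_mono:
  fixes s :: "nat \<Rightarrow> real"
  assumes "\<And>k. k < N \<Longrightarrow> s k \<le> s (Suc k)" "k \<le> l" "l \<le> N"
  shows "s k \<le> s l"
  using assms(2,3)
proof (induction l)
  case (Suc l)
  then show ?case using assms(1)[of l] by (cases "k = Suc l") auto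
qed simp

context brownian begin

text \<open>
  The past enters \<open>Y\<close> only, so it factors out of the expectation: the first two parts make the cross
  terms in the square of a stochastic sum vanish, the last two give its diagonal terms.
\<close>

lemma increment_times_past:
  fixes Y :: "'a \<Rightarrow> real"
  assumes st: "0 \<le> s" "s < t" and Y: "Y \<in> borel_measurable (F s)" "integrable M Y"
  shows "integrable M (\<lambda>\<omega>. Y \<omega> * (W t \<omega> - W s \<omega>) $ i)"
    and "expectation (\<lambda>\<omega>. Y \<omega> * (W t \<omega> - W s \<omega>) $ i) = 0"
    and "integrable M (\<lambda>\<omega>. Y \<omega> * (norm (W t \<omega> - W s \<omega>))\<^sup>2)"
    and "expectation (\<lambda>\<omega>. Y \<omega> * (norm (W t \<omega> - W s \<omega>))\<^sup>2)
      = expectation Y * (real CARD('d) * (t - s))"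
proof -
  let ?D = "\<lambda>\<omega>. W t \<omega> - W s \<omega>"
  have ind1: "indep_var borel Y borel (\<lambda>\<omega>. ?D \<omega> $ i)"
    by (rule increment_indep[OF st Y(1)]) simp
  have ind2: "indep_var borel Y borel (\<lambda>\<omega>. (norm (?D \<omega>))\<^sup>2)"
    by (rule increment_indep[OF st Y(1)]) simp
  note m = increment_moments[OF st, of i] and n = increment_norm_moment[OF st]
  show "integrable M (\<lambda>\<omega>. Y \<omega> * ?D \<omega> $ i)"
    by (rule indep_var_integrable[OF ind1 Y(2) m(1)])
  show "expectation (\<lambda>\<omega>. Y \<omega> * ?D \<omega> $ i) = 0"
    using indep_var_lebesgue_integral[OF ind1 Y(2) m(1)] m(2) by simp
  show "integrable M (\<lambda>\<omega>. Y \<omega> * (norm (?D \<omega>))\<^sup>2)"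
    by (rule indep_var_integrable[OF ind2 Y(2) n(1)])
  show "expectation (\<lambda>\<omega>. Y \<omega> * (norm (?D \<omega>))\<^sup>2) = expectation Y * (real CARD('d) * (t - s))"
    using indep_var_lebesgue_integral[OF ind2 Y(2) n(1)] n(2) by simp
qed

text \<open>
  One half of the Ito isometry for step integrands, up to the factor \<open>CARD('d)\<close>: this factor is lost
  by the Cauchy-Schwarz inequality for each summand, which replaces the computation of the covariance
  matrix of an increment.  Times may coincide, so that a partition can be cut off at a fixed time.
\<close>

lemma step_sum_second_moment:
  fixes \<eta> :: "nat \<Rightarrow> 'a \<Rightarrow> real^'d" and s :: "nat \<Rightarrow> real" and N :: nat
  defines "S \<equiv> \<lambda>n \<omega>. \<Sum>k<n. \<eta> k \<omega> \<bullet> (W (s (Suc k)) \<omega> - W (s k) \<omega>)"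
  assumes s: "0 \<le> s 0" "\<And>k. k < N \<Longrightarrow> s k \<le> s (Suc k)"
    and \<eta>: "\<And>k. k < N \<Longrightarrow> \<eta> k \<in> borel_measurable (F (s k))"
      "\<And>k. k < N \<Longrightarrow> bounded (\<eta> k ` space M)"
  shows "S N \<in> borel_measurable (F (s N)) \<and> integrable M (\<lambda>\<omega>. (S N \<omega>)\<^sup>2) \<and> 0 \<le> s N \<and>
    expectation (\<lambda>\<omega>. (S N \<omega>)\<^sup>2)
      \<le> real CARD('d) * (\<Sum>k<N. expectation (\<lambda>\<omega>. (norm (\<eta> k \<omega>))\<^sup>2) * (s (Suc k) - s k))"
  using s \<eta>
proof (induction N)
  case 0
  then show ?case by (simp add: S_def)
next
  case (Suc n)
  let ?t = "s (Suc n)" and ?D = "\<lambda>\<omega>. W (s (Suc n)) \<omega> - W (s n) \<omega>"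
  have IH: "S n \<in> borel_measurable (F (s n))" "integrable M (\<lambda>\<omega>. (S n \<omega>)\<^sup>2)" "0 \<le> s n"
    "expectation (\<lambda>\<omega>. (S n \<omega>)\<^sup>2)
      \<le> real CARD('d) * (\<Sum>k<n. expectation (\<lambda>\<omega>. (norm (\<eta> k \<omega>))\<^sup>2) * (s (Suc k) - s k))"
    using Suc by auto
  have st: "s n \<le> ?t" using Suc.prems by simp
  have [measurable]: "S n \<in> borel_measurable (F (s n))" "\<eta> n \<in> borel_measurable (F (s n))"
    using IH Suc.prems by auto
  note [measurable] = measurable_F[OF IH(1)] measurable_F[OF Suc.prems(3)[OF lessI]]
  have SS: "S (Suc n) \<omega> = S n \<omega> + \<eta> n \<omega> \<bullet> ?D \<omega>" for \<omega>
    by (simp add: S_def)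
  have meas: "S (Suc n) \<in> borel_measurable (F ?t)"
  proof -
    have [measurable]: "S n \<in> borel_measurable (F ?t)" "\<eta> n \<in> borel_measurable (F ?t)"
      "W ?t \<in> borel_measurable (F ?t)" "W (s n) \<in> borel_measurable (F ?t)"
      using IH(3) st measurable_le[OF IH(1) st] measurable_le[OF Suc.prems(3)[OF lessI] st]
      by (auto intro: W_adapted)
    show ?thesis unfolding SS[abs_def] by measurable
  qed
  show ?case
  proof (cases "s n = ?t")
    case True
    then show ?thesis
      using IH meas by (simp add: SS[abs_def])
  next
    case False
    then have lt: "s n < ?t" using st by simp
    have [measurable]: "?D \<in> borel_measurable M" using IH lt by auto
    obtain B where B: "\<And>\<omega>. \<omega> \<in> space M \<Longrightarrow> norm (\<eta> n \<omega>) \<le> B"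
      using Suc.prems(4)[of n] unfolding bounded_iff by auto
    have Bc: "\<bar>\<eta> n \<omega> $ i\<bar> \<le> B" if "\<omega> \<in> space M" for \<omega> i
      using B[OF that] component_le_norm_cart[of "\<eta> n \<omega>" i] by linarith
    have intS: "integrable M (S n)"
      by (rule square_integrable_imp_integrable) (use IH in auto)
    have intc: "integrable M (\<lambda>\<omega>. S n \<omega> * \<eta> n \<omega> $ i)" for i
    proof (rule Bochner_Integration.integrable_bound)
      show "integrable M (\<lambda>\<omega>. B * \<bar>S n \<omega>\<bar>)"
        using intS by auto
      show "AE \<omega> in M. norm (S n \<omega> * \<eta> n \<omega> $ i) \<le> norm (B * \<bar>S n \<omega>\<bar>)"
      proof (rule AE_I2)
        fix \<omega> assume "\<omega> \<in> space M"
        then have "\<bar>\<eta> n \<omega> $ i\<bar> \<le> \<bar>B\<bar>"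
          by (rule order_trans[OF Bc abs_ge_self])
        then show "norm (S n \<omega> * \<eta> n \<omega> $ i) \<le> norm (B * \<bar>S n \<omega>\<bar>)"
          using mult_left_mono[of "\<bar>\<eta> n \<omega> $ i\<bar>" "\<bar>B\<bar>" "\<bar>S n \<omega>\<bar>"]
          by (simp add: abs_mult mult.commute)
      qed
    qed measurable
    have cmeas: "(\<lambda>\<omega>. S n \<omega> * \<eta> n \<omega> $ i) \<in> borel_measurable (F (s n))" for i
      by measurable
    note cross = increment_times_past[OF IH(3) lt cmeas intc]
    have int_eta: "integrable M (\<lambda>\<omega>. (norm (\<eta> n \<omega>))\<^sup>2)"
      by (rule integrable_const_bound[where B="B\<^sup>2"]) (use B in \<open>auto intro!: AE_I2 power_mono\<close>)
    have etameas: "(\<lambda>\<omega>. (norm (\<eta> n \<omega>))\<^sup>2) \<in> borel_measurable (F (s n))"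
      by measurable
    note quad = increment_times_past(3,4)[OF IH(3) lt etameas int_eta]
    have CS: "(\<eta> n \<omega> \<bullet> ?D \<omega>)\<^sup>2 \<le> (norm (\<eta> n \<omega>))\<^sup>2 * (norm (?D \<omega>))\<^sup>2" for \<omega>
      using Cauchy_Schwarz_ineq[of "\<eta> n \<omega>" "?D \<omega>"] by (simp add: power2_norm_eq_inner)
    have int_q: "integrable M (\<lambda>\<omega>. (\<eta> n \<omega> \<bullet> ?D \<omega>)\<^sup>2)"
      by (rule Bochner_Integration.integrable_bound[OF quad(1)])
        (use CS in \<open>auto intro!: AE_I2 borel_measurable_power borel_measurable_inner\<close>)
    have le_q: "expectation (\<lambda>\<omega>. (\<eta> n \<omega> \<bullet> ?D \<omega>)\<^sup>2)
        \<le> real CARD('d) * (expectation (\<lambda>\<omega>. (norm (\<eta> n \<omega>))\<^sup>2) * (?t - s n))"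
      using integral_mono[OF int_q quad(1) CS] quad(2) by (simp add: mult_ac)
    \<comment> \<open>The cross term is expanded into coordinates of the increment, each multiplied by a random
      variable that is known at time \<open>s n\<close>.\<close>
    have sq: "(S (Suc n) \<omega>)\<^sup>2 = (S n \<omega>)\<^sup>2 + 2 * (\<Sum>i\<in>UNIV. S n \<omega> * \<eta> n \<omega> $ i * ?D \<omega> $ i)
        + (\<eta> n \<omega> \<bullet> ?D \<omega>)\<^sup>2" for \<omega>
      by (simp add: SS power2_sum inner_vec_def sum_distrib_left mult.assoc)
    have int_cross: "integrable M (\<lambda>\<omega>. \<Sum>i\<in>UNIV. S n \<omega> * \<eta> n \<omega> $ i * ?D \<omega> $ i)"
      by (intro Bochner_Integration.integrable_sum cross(1))
    have E_cross: "expectation (\<lambda>\<omega>. \<Sum>i\<in>UNIV. S n \<omega> * \<eta> n \<omega> $ i * ?D \<omega> $ i) = 0"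
      by (subst Bochner_Integration.integral_sum) (simp_all only: cross(1,2) sum.neutral_const)
    have "integrable M (\<lambda>\<omega>. (S (Suc n) \<omega>)\<^sup>2)"
      unfolding sq by (intro Bochner_Integration.integrable_add integrable_mult_right IH int_cross int_q)
    moreover have "expectation (\<lambda>\<omega>. (S (Suc n) \<omega>)\<^sup>2)
        = expectation (\<lambda>\<omega>. (S n \<omega>)\<^sup>2) + expectation (\<lambda>\<omega>. (\<eta> n \<omega> \<bullet> ?D \<omega>)\<^sup>2)"
      unfolding sq using IH(2) int_cross int_q E_cross by simp
    ultimately show ?thesis
      using meas IH lt le_q by (simp add: distrib_left)
  qed
qed

text \<open>
  Lenglart's inequality for step integrands.  The coefficients \<open>\<eta>' k\<close> are \<open>\<eta> k\<close> until the accumulated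
  energy \<open>V\<close> would exceed \<open>\<kappa>\<close>, and 0 from then on.  The energy up to and including step \<open>k\<close> is known
  at the beginning of this step, so \<open>\<eta>'\<close> is still nonanticipating; its total energy is at most \<open>\<kappa>\<close>
  everywhere, which controls the second moment of its sum; and it equals \<open>\<eta>\<close> unless \<open>\<kappa> < V N\<close>.
\<close>

lemma step_sum_deviation:
  fixes \<eta> :: "nat \<Rightarrow> 'a \<Rightarrow> real^'d" and s :: "nat \<Rightarrow> real" and N :: nat
  defines "S \<equiv> \<lambda>\<omega>. \<Sum>k<N. \<eta> k \<omega> \<bullet> (W (s (Suc k)) \<omega> - W (s k) \<omega>)"
    and "V \<equiv> \<lambda>n \<omega>. \<Sum>k<n. (norm (\<eta> k \<omega>))\<^sup>2 * (s (Suc k) - s k)"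
  assumes s: "0 \<le> s 0" "\<And>k. k < N \<Longrightarrow> s k \<le> s (Suc k)"
    and \<eta>: "\<And>k. k < N \<Longrightarrow> \<eta> k \<in> borel_measurable (F (s k))"
      "\<And>k. k < N \<Longrightarrow> bounded (\<eta> k ` space M)"
    and pos: "0 \<le> \<kappa>" "0 < \<delta>"
  shows "prob {\<omega>\<in>space M. \<delta> < \<bar>S \<omega>\<bar>}
    \<le> prob {\<omega>\<in>space M. \<kappa> < V N \<omega>} + real CARD('d) * \<kappa> / \<delta>\<^sup>2"
proof -
  define \<eta>' where "\<eta>' k \<omega> = (if V (Suc k) \<omega> \<le> \<kappa> then \<eta> k \<omega> else 0)" for k \<omega>
  define S' where "S' \<omega> = (\<Sum>k<N. \<eta>' k \<omega> \<bullet> (W (s (Suc k)) \<omega> - W (s k) \<omega>))" for \<omega>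
  note mono = steps_mono[of N s, OF s(2)]
  have Vmeas: "V (Suc k) \<in> borel_measurable (F (s k))" if "k < N" for k
  proof -
    have "(\<lambda>\<omega>. (norm (\<eta> j \<omega>))\<^sup>2 * (s (Suc j) - s j)) \<in> borel_measurable (F (s k))" if j: "j < Suc k" for j
    proof -
      have [measurable]: "\<eta> j \<in> borel_measurable (F (s k))"
        using \<eta>(1)[of j] mono[of j k] \<open>k < N\<close> j by (auto intro: measurable_le)
      show ?thesis by measurable
    qed
    then show ?thesis
      unfolding V_def by (intro borel_measurable_sum) auto
  qed
  have Vmono: "V k \<omega> \<le> V l \<omega>" if "k \<le> l" "l \<le> N" for k l \<omega>
    unfolding V_def by (rule sum_mono2) (use that s(2) in auto)
  have V'bound: "(\<Sum>k<n. (norm (\<eta>' k \<omega>))\<^sup>2 * (s (Suc k) - s k)) \<le> \<kappa>" if "n \<le> N" for n \<omega>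
    using that
  proof (induction n)
    case (Suc n)
    show ?case
    proof (cases "V (Suc n) \<omega> \<le> \<kappa>")
      case True
      have "(\<Sum>k<Suc n. (norm (\<eta>' k \<omega>))\<^sup>2 * (s (Suc k) - s k)) \<le> V (Suc n) \<omega>"
        unfolding V_def by (rule sum_mono) (use s(2) Suc.prems in \<open>auto simp: \<eta>'_def\<close>)
      then show ?thesis using True by simp
    next
      case False
      then have "\<eta>' n \<omega> = 0" by (simp add: \<eta>'_def)
      then show ?thesis using Suc by simp
    qed
  qed (use pos in simp)
  have \<eta>'meas: "\<eta>' k \<in> borel_measurable (F (s k))" if "k < N" for k
  proof -
    note [measurable] = Vmeas[OF that] \<eta>(1)[OF that]
    show ?thesis unfolding \<eta>'_def by measurable
  qed
  have \<eta>'bdd: "bounded (\<eta>' k ` space M)" if k: "k < N" for k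
  proof -
    obtain B where "\<And>\<omega>. \<omega> \<in> space M \<Longrightarrow> norm (\<eta> k \<omega>) \<le> B"
      using \<eta>(2)[OF k] unfolding bounded_iff by auto
    then have "norm (\<eta>' k \<omega>) \<le> \<bar>B\<bar>" if "\<omega> \<in> space M" for \<omega>
      using that unfolding \<eta>'_def by fastforce
    then show ?thesis unfolding bounded_iff by auto
  qed
  have *: "S' \<in> borel_measurable (F (s N))" "integrable M (\<lambda>\<omega>. (S' \<omega>)\<^sup>2)"
    "expectation (\<lambda>\<omega>. (S' \<omega>)\<^sup>2)
      \<le> real CARD('d) * (\<Sum>k<N. expectation (\<lambda>\<omega>. (norm (\<eta>' k \<omega>))\<^sup>2) * (s (Suc k) - s k))"
    using step_sum_second_moment[of s N \<eta>', OF s \<eta>'meas \<eta>'bdd] by (auto simp: S'_def[abs_def])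
  have int: "integrable M (\<lambda>\<omega>. (norm (\<eta>' k \<omega>))\<^sup>2)" if k: "k < N" for k
  proof -
    note [measurable] = measurable_F[OF \<eta>'meas[OF k]]
    obtain B where "\<And>\<omega>. \<omega> \<in> space M \<Longrightarrow> norm (\<eta>' k \<omega>) \<le> B"
      using \<eta>'bdd[OF k] unfolding bounded_iff by auto
    then show ?thesis
      by (intro integrable_const_bound[where B="B\<^sup>2"]) (auto intro!: AE_I2 power_mono)
  qed
  have "(\<Sum>k<N. expectation (\<lambda>\<omega>. (norm (\<eta>' k \<omega>))\<^sup>2) * (s (Suc k) - s k))
      = expectation (\<lambda>\<omega>. \<Sum>k<N. (norm (\<eta>' k \<omega>))\<^sup>2 * (s (Suc k) - s k))"
    using int by (subst Bochner_Integration.integral_sum) auto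
  also have "\<dots> \<le> expectation (\<lambda>\<omega>. \<kappa>)"
    using int V'bound by (intro integral_mono Bochner_Integration.integrable_sum) auto
  finally have "(\<Sum>k<N. expectation (\<lambda>\<omega>. (norm (\<eta>' k \<omega>))\<^sup>2) * (s (Suc k) - s k)) \<le> \<kappa>"
    by (simp add: prob_space)
  then have E: "expectation (\<lambda>\<omega>. (S' \<omega>)\<^sup>2) \<le> real CARD('d) * \<kappa>"
    using *(3) by (meson mult_left_mono of_nat_0_le_iff order_trans)
  have [measurable]: "S' \<in> borel_measurable M" "V N \<in> borel_measurable M"
  proof -
    show "S' \<in> borel_measurable M" using measurable_F[OF *(1)] .
    show "V N \<in> borel_measurable M"
      by (cases N) (use measurable_F[OF Vmeas] in \<open>auto simp: V_def[abs_def]\<close>)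
  qed
  have "prob {\<omega>\<in>space M. \<delta>\<^sup>2 \<le> (S' \<omega>)\<^sup>2} \<le> expectation (\<lambda>\<omega>. (S' \<omega>)\<^sup>2) / \<delta>\<^sup>2"
    by (rule integral_Markov_inequality_measure[where A="{}"]) (use *(2) pos in auto)
  also have "\<dots> \<le> real CARD('d) * \<kappa> / \<delta>\<^sup>2"
    using E by (simp add: divide_right_mono)
  finally have cheb: "prob {\<omega>\<in>space M. \<delta>\<^sup>2 \<le> (S' \<omega>)\<^sup>2} \<le> real CARD('d) * \<kappa> / \<delta>\<^sup>2" .
  have "{\<omega>\<in>space M. \<delta> < \<bar>S \<omega>\<bar>} \<subseteq> {\<omega>\<in>space M. \<kappa> < V N \<omega>} \<union> {\<omega>\<in>space M. \<delta>\<^sup>2 \<le> (S' \<omega>)\<^sup>2}"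
  proof safe
    fix \<omega> assume \<omega>: "\<omega> \<in> space M" "\<delta> < \<bar>S \<omega>\<bar>" "\<not> \<delta>\<^sup>2 \<le> (S' \<omega>)\<^sup>2"
    have "V N \<omega> \<le> \<kappa> \<Longrightarrow> S' \<omega> = S \<omega>"
      unfolding S_def S'_def using Vmono[OF Suc_leI order_refl]
      by (intro sum.cong) (auto simp: \<eta>'_def intro: order_trans)
    moreover have "\<delta>\<^sup>2 \<le> (S \<omega>)\<^sup>2"
      using \<omega>(2) pos by (metis abs_le_square_iff abs_of_pos less_eq_real_def)
    ultimately show "\<kappa> < V N \<omega>" using \<omega> by fastforce
  qed
  then have "prob {\<omega>\<in>space M. \<delta> < \<bar>S \<omega>\<bar>}
      \<le> prob ({\<omega>\<in>space M. \<kappa> < V N \<omega>} \<union> {\<omega>\<in>space M. \<delta>\<^sup>2 \<le> (S' \<omega>)\<^sup>2})"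
    by (intro finite_measure_mono) auto
  also have "\<dots> \<le> prob {\<omega>\<in>space M. \<kappa> < V N \<omega>} + prob {\<omega>\<in>space M. \<delta>\<^sup>2 \<le> (S' \<omega>)\<^sup>2}"
    by (rule measure_Un_le) auto
  finally show ?thesis using cheb by simp
qed

end

section \<open>Deviation of the Ito integral from a constant integrand\<close>

text \<open>
  The intervals are pairwise disjoint, so at any time at most one summand is present.
\<close>

lemma sum_indicator_steps:
  fixes s :: "nat \<Rightarrow> real" and g :: "nat \<Rightarrow> 'b::real_vector"
  assumes "\<And>k. k < N \<Longrightarrow> s k \<le> s (Suc k)"
  shows "k < N \<Longrightarrow> t \<in> {s k<..s (Suc k)} \<Longrightarrow> (\<Sum>j<N. indicator {s j<..s (Suc j)} t *\<^sub>R g j) = g k"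
    and "t \<notin> {s 0<..s N} \<Longrightarrow> (\<Sum>j<N. indicator {s j<..s (Suc j)} t *\<^sub>R g j) = 0"
proof -
  note mono = steps_mono[of N s, OF assms]
  assume k: "k < N" and t: "t \<in> {s k<..s (Suc k)}"
  have "t \<notin> {s j<..s (Suc j)}" if "j < N" "j \<noteq> k" for j
    using that k t mono[of "Suc j" k] mono[of "Suc k" j] by (cases "j < k") auto
  then have "(\<Sum>j<N. indicator {s j<..s (Suc j)} t *\<^sub>R g j) = (\<Sum>j<N. if j = k then g j else 0)"
    using t by (intro sum.cong) auto
  then show "(\<Sum>j<N. indicator {s j<..s (Suc j)} t *\<^sub>R g j) = g k"
    using k by simp
next
  note mono = steps_mono[of N s, OF assms]
  assume t: "t \<notin> {s 0<..s N}"
  have "t \<notin> {s j<..s (Suc j)}" if "j < N" for j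
    using that t mono[of 0 j] mono[of "Suc j" N] by auto
  then show "(\<Sum>j<N. indicator {s j<..s (Suc j)} t *\<^sub>R g j) = 0"
    by (intro sum.neutral) auto
qed

lemma norm_vector_matrix_mult_le: "norm (u v* A) \<le> norm u * norm (A :: real^'d^'r)"
proof -
  have "u v* A = (\<Sum>i\<in>UNIV. u $ i *\<^sub>R A $ i)"
    by (simp add: vec_eq_iff vector_matrix_mult_def mult.commute)
  then have "norm (u v* A) \<le> (\<Sum>i\<in>UNIV. \<bar>u $ i\<bar> * \<bar>norm (A $ i)\<bar>)"
    by (simp add: order_trans[OF norm_sum])
  also have "\<dots> \<le> norm u * norm A"
    unfolding norm_vec_def by (intro order_trans[OF L2_set_mult_ineq]) (simp add: L2_set_def)
  finally show ?thesis .
qed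

lemma bounded_linear_vector_matrix_mult: "bounded_linear (\<lambda>A :: real^'d^'r. u v* A)"
  by (rule bounded_linear_intro[where K="norm u"])
    (auto simp: vector_matrix_mult_def vec_eq_iff algebra_simps sum.distrib sum_distrib_left
      norm_vector_matrix_mult_le[unfolded vector_matrix_mult_def mult.commute[of "norm u"]])

lemmas vm_linear = bounded_linear.linear[OF bounded_linear_vector_matrix_mult]

context brownian begin

lemma simple_process_measurable:
  fixes \<xi> :: "nat \<Rightarrow> 'a \<Rightarrow> real^'d^'r"
  assumes "simple_integrand M F n \<tau> \<xi>"
  shows "(\<lambda>(\<omega>, t). simple_process n \<tau> \<xi> t \<omega>) \<in> borel_measurable (M \<Otimes>\<^sub>M lborel)"
proof -
  have "(\<lambda>x. indicator {\<tau> k<..\<tau> (Suc k)} (snd x) *\<^sub>R \<xi> k (fst x)) \<in> borel_measurable (M \<Otimes>\<^sub>M lborel)"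
    if "k < n" for k
  proof -
    have [measurable]: "\<xi> k \<in> borel_measurable M"
      using assms that measurable_F unfolding simple_integrand_def by blast
    show ?thesis by measurable
  qed
  then show ?thesis
    unfolding simple_process_def split_beta by (intro borel_measurable_sum) auto
qed

lemma simple_integral_measurable:
  fixes \<xi> :: "nat \<Rightarrow> 'a \<Rightarrow> real^'d^'r"
  assumes simple: "simple_integrand M F n \<tau> \<xi>" and T: "0 \<le> T"
  shows "simple_integral W n \<tau> \<xi> T \<in> borel_measurable M"
proof -
  have \<tau>: "0 \<le> \<tau> k" if "k \<le> n" for k
    using simple steps_mono[of n \<tau> 0 k] that by (force simp: simple_integrand_def less_imp_le)
  have "(\<lambda>\<omega>. \<xi> k \<omega> *v (W (min T (\<tau> (Suc k))) \<omega> - W (min T (\<tau> k)) \<omega>)) \<in> borel_measurable M"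
    if "k < n" for k
  proof -
    have [measurable]: "\<xi> k \<in> borel_measurable M"
      using simple that measurable_F unfolding simple_integrand_def by blast
    have [measurable]: "W (min T (\<tau> (Suc k))) \<in> borel_measurable M" "W (min T (\<tau> k)) \<in> borel_measurable M"
      using \<tau>[of k] \<tau>[of "Suc k"] that T by (auto intro!: W_measurable)
    have "continuous_on UNIV (\<lambda>p :: (real^'d^'r) \<times> (real^'d). fst p *v snd p)"
      unfolding matrix_vector_mult_def by (intro continuous_intros)
    then have m: "(\<lambda>p :: (real^'d^'r) \<times> (real^'d). fst p *v snd p) \<in> borel_measurable borel"
      by (rule borel_measurable_continuous_onI)
    have "(\<lambda>\<omega>. (\<xi> k \<omega>, W (min T (\<tau> (Suc k))) \<omega> - W (min T (\<tau> k)) \<omega>)) \<in> borel_measurable M"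
      by (intro borel_measurable_Pair) measurable
    from measurable_compose[OF this m] show ?thesis by simp
  qed
  then show ?thesis
    unfolding simple_integral_def[abs_def] by (intro borel_measurable_sum) auto
qed

text \<open>
  The difference of a simple integral and \<open>B *v (W T - W 0)\<close>, tested against \<open>u\<close>, is a sum of
  increments of \<open>W\<close> over the partition \<open>0, min T (\<tau> 0), \<dots>, min T (\<tau> n), T\<close>: on the first and the
  last interval the simple integrand is 0, which leaves \<open>- (u v* B)\<close> as coefficient.  To this sum
  the deviation inequality for step integrands applies.
\<close>

lemma simple_integral_deviation:
  fixes \<xi> :: "nat \<Rightarrow> 'a \<Rightarrow> real^'d^'r" and B :: "real^'d^'r"
  assumes simple: "simple_integrand M F n \<tau> \<xi>" and T: "0 < T" and pos: "0 \<le> \<kappa>" "0 < \<delta>"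
  shows "prob {\<omega>\<in>space M. \<delta> < \<bar>u \<bullet> (simple_integral W n \<tau> \<xi> T \<omega> - B *v (W T \<omega> - W 0 \<omega>))\<bar>}
    \<le> measure M {\<omega>\<in>space M. ennreal \<kappa> <
          (\<integral>\<^sup>+ t\<in>{0..T}. ennreal ((norm (u v* (simple_process n \<tau> \<xi> t \<omega> - B)))\<^sup>2) \<partial>lborel)}
      + real CARD('d) * \<kappa> / \<delta>\<^sup>2"
proof -
  have \<tau>: "0 \<le> \<tau> 0" "\<And>k. k < n \<Longrightarrow> \<tau> k \<le> \<tau> (Suc k)"
    and \<xi>: "\<And>k. k < n \<Longrightarrow> \<xi> k \<in> borel_measurable (F (\<tau> k))" "\<And>k. k < n \<Longrightarrow> bounded (\<xi> k ` space M)"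
    using simple by (auto simp: simple_integrand_def less_imp_le)
  have \<tau>0: "0 \<le> \<tau> k" if "k \<le> n" for k
    using steps_mono[of n \<tau> 0 k, OF \<tau>(2)] that \<tau>(1) by auto
  define s where "s k = (case k of 0 \<Rightarrow> 0 | Suc k \<Rightarrow> if k \<le> n then min T (\<tau> k) else T)" for k
  define v where "v = u v* B"
  \<comment> \<open>A coefficient that belongs to \<open>\<tau> k \<ge> T\<close> is set to 0: its interval degenerates to the point
    \<open>T\<close>, and \<open>\<xi> k\<close> need not be measurable with respect to \<open>F T\<close>.\<close>
  define \<eta> where "\<eta> k \<omega> = (case k of 0 \<Rightarrow> - v | Suc k \<Rightarrow>
      if k < n then (if \<tau> k < T then u v* (\<xi> k \<omega>) - v else 0) else - v)" for k \<omega>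
  have s: "0 \<le> s 0" "\<And>k. k < n + 2 \<Longrightarrow> s k \<le> s (Suc k)"
    using \<tau>0 T min.coboundedI2[OF \<tau>(2), of _ T] by (auto simp: s_def Suc_le_eq split: nat.splits)
  have \<eta>m: "\<eta> k \<in> borel_measurable (F (s k))" if "k < n + 2" for k
  proof -
    have "\<eta> (Suc j) \<in> borel_measurable (F (s (Suc j)))" for j
    proof (cases "j < n \<and> \<tau> j < T")
      case True
      then have "s (Suc j) = \<tau> j" by (simp add: s_def)
      moreover have "(\<lambda>\<omega>. u v* (\<xi> j \<omega>)) \<in> borel_measurable (F (\<tau> j))"
        by (rule measurable_compose[OF \<xi>(1)])
          (use True in \<open>auto intro!: borel_measurable_continuous_onI linear_continuous_on bounded_linear_vector_matrix_mult\<close>)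
      ultimately show ?thesis using True by (simp add: \<eta>_def[abs_def])
    next
      case False
      then show ?thesis by (cases "j < n") (simp_all add: \<eta>_def[abs_def])
    qed
    then show ?thesis by (cases k) (simp_all add: \<eta>_def[abs_def])
  qed
  have \<eta>b: "bounded (\<eta> k ` space M)" if "k < n + 2" for k
  proof -
    have "bounded ((\<lambda>\<omega>. u v* (\<xi> j \<omega>) - v) ` space M)" if "j < n" for j
    proof -
      have "bounded ((\<lambda>x. x - v) ` (\<lambda>A. u v* A) ` \<xi> j ` space M)"
        by (intro bounded_minus_comp bounded_linear_image[OF \<xi>(2)[OF that]] bounded_linear_vector_matrix_mult
            bounded_translation_minus)
      then show ?thesis by (simp add: image_image)
    qed
    moreover have "bounded ((\<lambda>\<omega>::'a. c) ` space M)" for c :: "real^'d"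
      by (rule bounded_subset[of "{c}"]) auto
    ultimately show ?thesis
      by (cases k) (simp_all add: \<eta>_def[abs_def])
  qed
  have sum_eq: "(\<Sum>k<n+2. \<eta> k \<omega> \<bullet> (W (s (Suc k)) \<omega> - W (s k) \<omega>))
      = u \<bullet> (simple_integral W n \<tau> \<xi> T \<omega> - B *v (W T \<omega> - W 0 \<omega>))" for \<omega>
  proof -
    let ?w = "\<lambda>k. W (min T (\<tau> k)) \<omega>"
    have mid: "\<eta> (Suc k) \<omega> \<bullet> (W (s (Suc (Suc k))) \<omega> - W (s (Suc k)) \<omega>)
        = u \<bullet> (\<xi> k \<omega> *v (?w (Suc k) - ?w k)) - v \<bullet> (?w (Suc k) - ?w k)" if "k < n" for k
    proof (cases "\<tau> k < T")
      case True
      then show ?thesis using that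
        by (simp add: \<eta>_def s_def dot_lmul_matrix[symmetric] inner_diff_left)
    next
      case False
      then have "min T (\<tau> k) = T" "min T (\<tau> (Suc k)) = T" using \<tau>(2)[OF that] by auto
      then show ?thesis using that False by (simp add: \<eta>_def)
    qed
    have "(\<Sum>k<n+2. \<eta> k \<omega> \<bullet> (W (s (Suc k)) \<omega> - W (s k) \<omega>))
      = \<eta> 0 \<omega> \<bullet> (W (s 1) \<omega> - W (s 0) \<omega>)
        + (\<Sum>k<n. \<eta> (Suc k) \<omega> \<bullet> (W (s (Suc (Suc k))) \<omega> - W (s (Suc k)) \<omega>))
        + \<eta> (Suc n) \<omega> \<bullet> (W (s (Suc (Suc n))) \<omega> - W (s (Suc n)) \<omega>)"
      by (simp only: add_2_eq_Suc' sum.lessThan_Suc_shift[of _ "Suc n"] sum.lessThan_Suc[of _ n] One_nat_def add.assoc)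
    also have "\<dots> = - (v \<bullet> (?w 0 - W 0 \<omega>))
        + (\<Sum>k<n. u \<bullet> (\<xi> k \<omega> *v (?w (Suc k) - ?w k)) - v \<bullet> (?w (Suc k) - ?w k))
        - v \<bullet> (W T \<omega> - ?w n)"
    proof -
      have "(\<Sum>k<n. \<eta> (Suc k) \<omega> \<bullet> (W (s (Suc (Suc k))) \<omega> - W (s (Suc k)) \<omega>))
        = (\<Sum>k<n. u \<bullet> (\<xi> k \<omega> *v (?w (Suc k) - ?w k)) - v \<bullet> (?w (Suc k) - ?w k))"
        using mid by (intro sum.cong) auto
      then show ?thesis by (simp add: \<eta>_def s_def)
    qed
    also have "(\<Sum>k<n. u \<bullet> (\<xi> k \<omega> *v (?w (Suc k) - ?w k)) - v \<bullet> (?w (Suc k) - ?w k))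
        = u \<bullet> simple_integral W n \<tau> \<xi> T \<omega> - v \<bullet> (?w n - ?w 0)"
    proof -
      have "(\<Sum>k<n. v \<bullet> (?w (Suc k) - ?w k)) = v \<bullet> (?w n - ?w 0)"
        using sum_lessThan_telescope[of ?w n] by (simp add: inner_sum_right[symmetric])
      then show ?thesis
        by (simp add: sum_subtractf simple_integral_def inner_sum_right)
    qed
    also have "- (v \<bullet> (?w 0 - W 0 \<omega>)) + (u \<bullet> simple_integral W n \<tau> \<xi> T \<omega> - v \<bullet> (?w n - ?w 0))
        - v \<bullet> (W T \<omega> - ?w n) = u \<bullet> simple_integral W n \<tau> \<xi> T \<omega> - v \<bullet> (W T \<omega> - W 0 \<omega>)"
      by (simp add: inner_diff_right)
    also have "\<dots> = u \<bullet> (simple_integral W n \<tau> \<xi> T \<omega> - B *v (W T \<omega> - W 0 \<omega>))"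
      by (simp only: v_def dot_lmul_matrix inner_diff_right[of u])
    finally show ?thesis .
  qed
  have energy: "ennreal (\<Sum>k<n+2. (norm (\<eta> k \<omega>))\<^sup>2 * (s (Suc k) - s k))
      \<le> (\<integral>\<^sup>+ t\<in>{0..T}. ennreal ((norm (u v* (simple_process n \<tau> \<xi> t \<omega> - B)))\<^sup>2) \<partial>lborel)" for \<omega>
  proof -
    have "ennreal (\<Sum>k<n+2. (norm (\<eta> k \<omega>))\<^sup>2 * (s (Suc k) - s k))
        = (\<Sum>k<n+2. \<integral>\<^sup>+t. ennreal ((norm (\<eta> k \<omega>))\<^sup>2) * indicator {s k<..s (Suc k)} t \<partial>lborel)"
      using s(2) by (subst sum_ennreal[symmetric])
        (auto simp: nn_integral_cmult_indicator ennreal_mult intro!: sum.cong)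
    also have "\<dots> = (\<integral>\<^sup>+t. (\<Sum>k<n+2. ennreal ((norm (\<eta> k \<omega>))\<^sup>2) * indicator {s k<..s (Suc k)} t) \<partial>lborel)"
      by (rule nn_integral_sum[symmetric]) auto
    also have "\<dots> \<le> (\<integral>\<^sup>+ t\<in>{0..T}. ennreal ((norm (u v* (simple_process n \<tau> \<xi> t \<omega> - B)))\<^sup>2) \<partial>lborel)"
    proof (rule nn_integral_mono)
      fix t
      have eq: "(\<Sum>k<n+2. ennreal ((norm (\<eta> k \<omega>))\<^sup>2) * indicator {s k<..s (Suc k)} t)
          = ennreal (\<Sum>k<n+2. indicator {s k<..s (Suc k)} t *\<^sub>R (norm (\<eta> k \<omega>))\<^sup>2)"
        by (subst sum_ennreal[symmetric]) (auto intro!: sum.cong simp: indicator_def)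
      show "(\<Sum>k<n+2. ennreal ((norm (\<eta> k \<omega>))\<^sup>2) * indicator {s k<..s (Suc k)} t)
          \<le> ennreal ((norm (u v* (simple_process n \<tau> \<xi> t \<omega> - B)))\<^sup>2) * indicator {0..T} t"
      proof (cases "\<exists>k<n+2. t \<in> {s k<..s (Suc k)}")
        case False
        then have "(\<Sum>k<n+2. ennreal ((norm (\<eta> k \<omega>))\<^sup>2) * indicator {s k<..s (Suc k)} t) = 0"
          by (intro sum.neutral) auto
        then show ?thesis by (simp only: zero_le)
      next
        case True
        then obtain k where k: "k < n + 2" and t: "t \<in> {s k<..s (Suc k)}" by blast
        have tT: "t \<in> {0..T}"
          using t steps_mono[of "n+2" s 0 k, OF s(2)] steps_mono[of "n+2" s "Suc k" "n+2", OF s(2)] k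
          by (auto simp: s_def)
        have zero: "simple_process n \<tau> \<xi> t \<omega> = 0" if "t \<notin> {\<tau> 0<..\<tau> n}"
          unfolding simple_process_def using sum_indicator_steps(2)[of n \<tau>, OF \<tau>(2) that] .
        have "\<eta> k \<omega> = u v* (simple_process n \<tau> \<xi> t \<omega> - B)"
        proof (cases k)
          case 0
          then have "simple_process n \<tau> \<xi> t \<omega> = 0" using t by (intro zero) (auto simp: s_def)
          then show ?thesis using 0 by (simp add: \<eta>_def v_def linear_neg[OF vm_linear])
        next
          case (Suc j)
          show ?thesis
          proof (cases "j < n")
            case True
            then have tj: "t \<in> {\<tau> j<..\<tau> (Suc j)}" "\<tau> j < T"
              using t Suc by (auto simp: s_def split: if_splits)
            have "simple_process n \<tau> \<xi> t \<omega> = \<xi> j \<omega>"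
              unfolding simple_process_def by (rule sum_indicator_steps(1)[of n \<tau> j, OF \<tau>(2) True tj(1)])
            then show ?thesis using Suc True tj by (simp add: \<eta>_def v_def linear_diff[OF vm_linear])
          next
            case False
            then have "j = n" using k Suc by simp
            then have "simple_process n \<tau> \<xi> t \<omega> = 0" using t Suc by (intro zero) (auto simp: s_def min_def split: if_splits)
            then show ?thesis using Suc False by (simp add: \<eta>_def v_def linear_neg[OF vm_linear])
          qed
        qed
        moreover have "(\<Sum>k<n+2. indicator {s k<..s (Suc k)} t *\<^sub>R (norm (\<eta> k \<omega>))\<^sup>2) = (norm (\<eta> k \<omega>))\<^sup>2"
          by (rule sum_indicator_steps(1)[of "n+2" s k t "\<lambda>k. (norm (\<eta> k \<omega>))\<^sup>2", OF s(2) k t])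
        ultimately show ?thesis
          unfolding eq using tT by (simp del: sum.lessThan_Suc add_2_eq_Suc')
      qed
    qed
    finally show ?thesis .
  qed
  define E where "E = {\<omega>\<in>space M. ennreal \<kappa> <
      (\<integral>\<^sup>+ t\<in>{0..T}. ennreal ((norm (u v* (simple_process n \<tau> \<xi> t \<omega> - B)))\<^sup>2) \<partial>lborel)}"
  have [measurable]: "(\<lambda>A :: real^'d^'r. u v* A) \<in> borel_measurable borel"
    by (intro borel_measurable_continuous_onI linear_continuous_on bounded_linear_vector_matrix_mult)
  note [measurable] = simple_process_measurable[OF simple]
  have "E \<in> sets M"
    unfolding E_def by measurable
  then have "prob {\<omega>\<in>space M. \<kappa> < (\<Sum>k<n+2. (norm (\<eta> k \<omega>))\<^sup>2 * (s (Suc k) - s k))} \<le> prob E"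
  proof (intro finite_measure_mono subsetI)
    fix \<omega> assume \<omega>: "\<omega> \<in> {\<omega>\<in>space M. \<kappa> < (\<Sum>k<n+2. (norm (\<eta> k \<omega>))\<^sup>2 * (s (Suc k) - s k))}"
    then have "ennreal \<kappa> < ennreal (\<Sum>k<n+2. (norm (\<eta> k \<omega>))\<^sup>2 * (s (Suc k) - s k))"
      using pos by (intro ennreal_lessI) auto
    with \<omega> energy[of \<omega>] show "\<omega> \<in> E"
      unfolding E_def by (auto intro: less_le_trans)
  qed
  then show ?thesis
    using step_sum_deviation[of s "n+2" \<eta>, OF s \<eta>m \<eta>b pos] unfolding sum_eq E_def by linarith
qed

text \<open>
  Freezing the process outside \<open>[0, T]\<close> turns progressive measurability, which concerns a restricted
  space, into joint measurability on the full product space; there the measurability of integrals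
  over time is available.
\<close>

lemma progressive_clamped_measurable:
  fixes H :: "real \<Rightarrow> 'a \<Rightarrow> 'b::topological_space"
  assumes H: "progressively_measurable_upto F T H" and T: "0 \<le> T"
  shows "(\<lambda>(\<omega>, t). H (max 0 (min T t)) \<omega>) \<in> borel_measurable (M \<Otimes>\<^sub>M lborel)"
proof -
  have "(\<lambda>(s, \<omega>). H s \<omega>) \<in> borel_measurable (restrict_space borel {0..T} \<Otimes>\<^sub>M F T)"
    using H T unfolding progressively_measurable_upto_def by auto
  moreover have "(\<lambda>p. (max 0 (min T (snd p)), fst p)) \<in>
      measurable (M \<Otimes>\<^sub>M lborel) (restrict_space borel {0..T} \<Otimes>\<^sub>M F T)"
  proof (rule measurable_Pair)
    show "(\<lambda>p. max 0 (min T (snd p))) \<in> measurable (M \<Otimes>\<^sub>M lborel) (restrict_space borel {0..T})"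
      using T by (intro measurable_restrict_space2) auto
    show "fst \<in> measurable (M \<Otimes>\<^sub>M lborel) (F T)"
      by (rule measurable_compose[OF measurable_fst measurable_F[of "\<lambda>x. x" T "F T"]]) simp
  qed
  ultimately have "(\<lambda>p. (\<lambda>(s, \<omega>). H s \<omega>) (max 0 (min T (snd p)), fst p)) \<in> borel_measurable (M \<Otimes>\<^sub>M lborel)"
    by (rule measurable_compose[rotated])
  then show ?thesis by (simp add: split_beta)
qed

text \<open>
  On \<open>G\<close> the integrand differs from the constant \<open>B\<close> by at most \<open>r\<close>, so that the integral over
  \<open>[0, T]\<close> should differ from \<open>B *v (W T - W 0)\<close> by about \<open>r * sqrt T\<close>.  For \<open>\<delta>\<close> of the order
  \<open>sqrt T\<close> the last term does not depend on \<open>T\<close>.  The proof bounds the approximating simple integrals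
  and lets the two approximation errors tend to 0.
\<close>

lemma ito_integral_deviation:
  fixes H :: "real \<Rightarrow> 'a \<Rightarrow> real^'d^'r" and B :: "real^'d^'r"
  assumes ito: "has_ito_integral M F W H T I" and T: "0 < T"
    and G: "G \<in> sets M" "\<And>\<omega> t. \<omega> \<in> G \<Longrightarrow> t \<in> {0..T} \<Longrightarrow> norm (H t \<omega> - B) \<le> r"
    and pos: "0 < r" "0 < \<delta>"
  shows "prob {\<omega>\<in>space M. \<delta> < \<bar>u \<bullet> (I \<omega> - B *v (W T \<omega> - W 0 \<omega>))\<bar>}
    \<le> prob (space M - G) + 16 * real CARD('d) * T * (norm u * r / \<delta>)\<^sup>2"
proof -
  from ito obtain n \<tau> \<xi> where simple: "\<And>m. simple_integrand M F (n m) (\<tau> m) (\<xi> m)"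
    and conv: "\<And>e. e > 0 \<Longrightarrow> (\<lambda>m. measure M {\<omega>\<in>space M. ennreal e <
        (\<integral>\<^sup>+ s\<in>{0..T}. ennreal ((norm (simple_process (n m) (\<tau> m) (\<xi> m) s \<omega> - H s \<omega>))\<^sup>2) \<partial>lborel)})
        \<longlonglongrightarrow> 0"
    and conv_I: "\<And>e. e > 0 \<Longrightarrow> (\<lambda>m. measure M {\<omega>\<in>space M.
        e < dist (simple_integral W (n m) (\<tau> m) (\<xi> m) T \<omega>) (I \<omega>)}) \<longlonglongrightarrow> 0"
    and H: "progressively_measurable_upto F T H" and I[measurable]: "I \<in> borel_measurable M"
    unfolding has_ito_integral_def by blast
  define K where "K t \<omega> = H (max 0 (min T t)) \<omega>" for t \<omega>
  have [measurable]: "(\<lambda>(\<omega>, t). K t \<omega>) \<in> borel_measurable (M \<Otimes>\<^sub>M lborel)"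
    unfolding K_def using progressive_clamped_measurable[OF H] T by simp
  let ?sp = "\<lambda>m. simple_process (n m) (\<tau> m) (\<xi> m)"
  let ?si = "\<lambda>m. simple_integral W (n m) (\<tau> m) (\<xi> m) T"
  note [measurable] = simple_process_measurable[OF simple] simple_integral_measurable[OF simple less_imp_le[OF T]]
  define J where "J m \<omega> = (\<integral>\<^sup>+ t\<in>{0..T}. ennreal ((norm (?sp m t \<omega> - H t \<omega>))\<^sup>2) \<partial>lborel)" for m \<omega>
  have J_eq: "J m \<omega> = (\<integral>\<^sup>+ t. ennreal ((norm (?sp m t \<omega> - K t \<omega>))\<^sup>2) * indicator {0..T} t \<partial>lborel)" for m \<omega>
    unfolding J_def by (intro nn_integral_cong) (auto simp: K_def indicator_def)
  have [measurable]: "J m \<in> borel_measurable M" for m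
    unfolding J_eq[abs_def] by measurable
  \<comment> \<open>The energy of the tested simple integrand minus \<open>u v* B\<close> is at most
    \<open>\<bar>u\<bar>\<^sup>2 (2 J + 2 T r\<^sup>2)\<close> on \<open>G\<close>, hence at most \<open>\<kappa>\<close> unless \<open>J\<close>, the squared distance of the
    simple integrand to \<open>H\<close>, exceeds \<open>T r\<^sup>2\<close>.\<close>
  define \<kappa> where "\<kappa> = 4 * T * (norm u * r)\<^sup>2"
  \<comment> \<open>Half of \<open>\<delta>\<close> is reserved for replacing \<open>I\<close> by the simple integral.  The summand 1 covers
    \<open>u = 0\<close>.\<close>
  define q where "q = \<delta> / (2 * (norm u + 1))"
  have q: "0 < q" and uq: "norm u * q \<le> \<delta> / 2"
    using pos by (auto simp: q_def field_simps add_pos_nonneg add_nonneg_pos)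
  have bound: "prob {\<omega>\<in>space M. \<delta> < \<bar>u \<bullet> (I \<omega> - B *v (W T \<omega> - W 0 \<omega>))\<bar>}
      \<le> measure M {\<omega>\<in>space M. q < dist (?si m \<omega>) (I \<omega>)} + (measure M {\<omega>\<in>space M. ennreal (T * r\<^sup>2) < J m \<omega>}
        + (prob (space M - G) + real CARD('d) * \<kappa> / (\<delta> / 2)\<^sup>2))" for m
  proof -
    let ?A = "{\<omega>\<in>space M. q < dist (?si m \<omega>) (I \<omega>)}"
      and ?C = "{\<omega>\<in>space M. \<delta> / 2 < \<bar>u \<bullet> (?si m \<omega> - B *v (W T \<omega> - W 0 \<omega>))\<bar>}"
      and ?J = "{\<omega>\<in>space M. ennreal (T * r\<^sup>2) < J m \<omega>}"
      and ?E = "\<lambda>\<omega>. \<integral>\<^sup>+ t\<in>{0..T}. ennreal ((norm (u v* (?sp m t \<omega> - B)))\<^sup>2) \<partial>lborel"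
    have Bm: "(\<lambda>\<omega>. B *v (W T \<omega> - W 0 \<omega>)) \<in> borel_measurable M"
      by (rule measurable_compose[of _ M borel])
        (use T in \<open>auto intro!: borel_measurable_continuous_onI linear_continuous_on matrix_vector_mul_bounded_linear\<close>)
    have sets: "?A \<in> sets M" "?C \<in> sets M" "?J \<in> sets M"
      using Bm by measurable
    have "{\<omega>\<in>space M. \<delta> < \<bar>u \<bullet> (I \<omega> - B *v (W T \<omega> - W 0 \<omega>))\<bar>} \<subseteq> ?A \<union> ?C"
    proof safe
      fix \<omega> assume \<omega>: "\<omega> \<in> space M" "\<delta> < \<bar>u \<bullet> (I \<omega> - B *v (W T \<omega> - W 0 \<omega>))\<bar>"
        and nC: "\<not> \<delta> / 2 < \<bar>u \<bullet> (?si m \<omega> - B *v (W T \<omega> - W 0 \<omega>))\<bar>"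
      have "\<delta> / 2 < \<bar>u \<bullet> (I \<omega> - ?si m \<omega>)\<bar>"
        using \<omega>(2) nC unfolding inner_diff_right by linarith
      also have "\<dots> \<le> norm u * dist (?si m \<omega>) (I \<omega>)"
        by (metis Cauchy_Schwarz_ineq2 dist_norm norm_minus_commute)
      finally have "norm u * q < norm u * dist (?si m \<omega>) (I \<omega>)"
        using uq by linarith
      then show "q < dist (?si m \<omega>) (I \<omega>)"
        by (simp add: mult_less_cancel_left)
    qed
    then have "prob {\<omega>\<in>space M. \<delta> < \<bar>u \<bullet> (I \<omega> - B *v (W T \<omega> - W 0 \<omega>))\<bar>} \<le> prob (?A \<union> ?C)"
      by (rule finite_measure_mono) (rule sets.Un[OF sets(1,2)])
    also have "\<dots> \<le> prob ?A + prob ?C"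
      by (rule measure_Un_le[OF sets(1,2)])
    also have "prob ?C \<le> prob {\<omega>\<in>space M. ennreal \<kappa> < ?E \<omega>} + real CARD('d) * \<kappa> / (\<delta> / 2)\<^sup>2"
      by (rule simple_integral_deviation[OF simple T]) (use pos T in \<open>auto simp: \<kappa>_def\<close>)
    also have "prob {\<omega>\<in>space M. ennreal \<kappa> < ?E \<omega>} \<le> prob (?J \<union> (space M - G))"
    proof (rule finite_measure_mono)
      show "{\<omega>\<in>space M. ennreal \<kappa> < ?E \<omega>} \<subseteq> ?J \<union> (space M - G)"
      proof safe
        fix \<omega> assume \<omega>: "\<omega> \<in> space M" "ennreal \<kappa> < ?E \<omega>" and \<omega>G: "\<omega> \<in> G"
        show "ennreal (T * r\<^sup>2) < J m \<omega>"
        proof (rule ccontr)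
          assume "\<not> ennreal (T * r\<^sup>2) < J m \<omega>"
          then have J: "J m \<omega> \<le> ennreal (T * r\<^sup>2)" by simp
          let ?c = "ennreal (2 * (norm u)\<^sup>2)"
          have [measurable]: "(\<lambda>t. K t \<omega>) \<in> borel_measurable lborel" "(\<lambda>t. ?sp m t \<omega>) \<in> borel_measurable lborel"
            using \<omega>(1) by measurable
          have "?E \<omega> \<le> (\<integral>\<^sup>+ t. ?c * (ennreal ((norm (?sp m t \<omega> - K t \<omega>))\<^sup>2) * indicator {0..T} t
              + ennreal (r\<^sup>2) * indicator {0..T} t) \<partial>lborel)"
          proof (rule nn_integral_mono)
            fix t
            show "ennreal ((norm (u v* (?sp m t \<omega> - B)))\<^sup>2) * indicator {0..T} t
              \<le> ?c * (ennreal ((norm (?sp m t \<omega> - K t \<omega>))\<^sup>2) * indicator {0..T} t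
                + ennreal (r\<^sup>2) * indicator {0..T} t)"
            proof (cases "t \<in> {0..T}")
              case True
              let ?x = "norm (?sp m t \<omega> - K t \<omega>)"
              have "norm (K t \<omega> - B) \<le> r" using G(2)[OF \<omega>G True] True by (simp add: K_def)
              then have "norm (?sp m t \<omega> - B) \<le> ?x + r"
                using norm_triangle_ineq[of "?sp m t \<omega> - K t \<omega>" "K t \<omega> - B"] by simp
              then have "norm (u v* (?sp m t \<omega> - B)) \<le> norm u * (?x + r)"
                using norm_vector_matrix_mult_le[of u "?sp m t \<omega> - B"]
                by (meson mult_left_mono norm_ge_zero order_trans)
              then have "(norm (u v* (?sp m t \<omega> - B)))\<^sup>2 \<le> (norm u * (?x + r))\<^sup>2"
                by (rule power_mono) simp
              also have "\<dots> \<le> 2 * (norm u)\<^sup>2 * (?x\<^sup>2 + r\<^sup>2)"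
              proof -
                have "(?x + r)\<^sup>2 \<le> 2 * (?x\<^sup>2 + r\<^sup>2)"
                  using zero_le_power2[of "?x - r"] by (simp add: power2_sum power2_diff)
                from mult_left_mono[OF this zero_le_power2[of "norm u"]] show ?thesis
                  unfolding power_mult_distrib by (simp only: mult_ac)
              qed
              finally show ?thesis using True
                by (simp add: ennreal_leI flip: ennreal_mult ennreal_plus)
            qed simp
          qed
          also have "\<dots> = ?c * (J m \<omega> + ennreal (r\<^sup>2) * ennreal T)"
            unfolding J_eq using T by (simp add: nn_integral_cmult nn_integral_add nn_integral_cmult_indicator)
          also have "\<dots> \<le> ?c * (ennreal (T * r\<^sup>2) + ennreal (r\<^sup>2) * ennreal T)"
            by (intro mult_left_mono add_right_mono J) simp
          also have "\<dots> = ennreal \<kappa>"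
            using T by (simp add: \<kappa>_def power_mult_distrib algebra_simps flip: ennreal_mult ennreal_plus)
          finally show False using \<omega>(2) by simp
        qed
      qed
    next
      show "?J \<union> (space M - G) \<in> sets M" by (rule sets.Un[OF sets(3) sets.compl_sets[OF G(1)]])
    qed
    also have "prob (?J \<union> (space M - G)) \<le> prob ?J + prob (space M - G)"
      by (rule measure_Un_le[OF sets(3) sets.compl_sets[OF G(1)]])
    finally show ?thesis by simp
  qed
  have "(\<lambda>m. measure M {\<omega>\<in>space M. q < dist (?si m \<omega>) (I \<omega>)} + (measure M {\<omega>\<in>space M. ennreal (T * r\<^sup>2) < J m \<omega>}
        + (prob (space M - G) + real CARD('d) * \<kappa> / (\<delta> / 2)\<^sup>2)))
      \<longlonglongrightarrow> 0 + (0 + (prob (space M - G) + real CARD('d) * \<kappa> / (\<delta> / 2)\<^sup>2))"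
    unfolding J_def using conv[of "T * r\<^sup>2"] conv_I[OF q] T pos
    by (intro tendsto_add tendsto_const) auto
  then have "prob {\<omega>\<in>space M. \<delta> < \<bar>u \<bullet> (I \<omega> - B *v (W T \<omega> - W 0 \<omega>))\<bar>}
      \<le> 0 + (0 + (prob (space M - G) + real CARD('d) * \<kappa> / (\<delta> / 2)\<^sup>2))"
    by (rule LIMSEQ_le_const) (use bound in auto)
  then show ?thesis
    by (simp add: \<kappa>_def power_divide power_mult_distrib field_simps)
qed

end

section \<open>The second difference of a diffusion at its start\<close>

context brownian begin

text \<open>
  The first half-interval contributes an increment in \<open>[-2\<sigma>, -\<sigma>]\<close> and the second, independently, one
  in \<open>[\<sigma>, 2\<sigma>]\<close>, where \<open>\<sigma>\<^sup>2 = h/2\<close> is the variance of both.  The bound does not depend on \<open>h\<close>.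
\<close>

lemma opposite_increments_prob:
  assumes h: "0 < h"
  shows "(exp (-2) / sqrt (2 * pi))\<^sup>2
    \<le> prob {\<omega>\<in>space M. sqrt h \<le> (W h \<omega> - W (h/2) \<omega>) $ j - (W (h/2) \<omega> - W 0 \<omega>) $ j}"
proof -
  define \<sigma> where "\<sigma> = sqrt (h / 2)"
  define p where "p = exp (-2) / sqrt (2 * pi)"
  have \<sigma>: "0 < \<sigma>" using h by (simp add: \<sigma>_def)
  have p: "0 \<le> p" by (simp add: p_def)
  have st: "0 \<le> h/2" "h/2 < h" "0 < h/2" using h by auto
  have D1: "distributed M lborel (\<lambda>\<omega>. (W h \<omega> - W (h/2) \<omega>) $ j) (normal_density 0 \<sigma>)"
    using increment_normal[OF st(1,2), of j] by (simp add: \<sigma>_def)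
  have D2: "distributed M lborel (\<lambda>\<omega>. (W (h/2) \<omega> - W 0 \<omega>) $ j) (normal_density 0 \<sigma>)"
    using increment_normal[OF order_refl st(3), of j] by (simp add: \<sigma>_def)
  define A where "A = (\<lambda>\<omega>. (W (h/2) \<omega> - W 0 \<omega>) $ j) -` {-2*\<sigma>..-\<sigma>} \<inter> space M"
  define B where "B = {x :: real^'d. x $ j \<in> {\<sigma>..2*\<sigma>}}"
  define C where "C = (\<lambda>\<omega>. W h \<omega> - W (h/2) \<omega>) -` B \<inter> space M"
  have B[measurable]: "B \<in> sets borel" unfolding B_def by measurable
  have A: "A \<in> sets (F (h/2))"
  proof -
    have [measurable]: "W (h/2) \<in> borel_measurable (F (h/2))" "W 0 \<in> borel_measurable (F (h/2))"
      using st by (auto intro: W_adapted)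
    have "(\<lambda>\<omega>. (W (h/2) \<omega> - W 0 \<omega>) $ j) -` {-2*\<sigma>..-\<sigma>} \<inter> space (F (h/2)) \<in> sets (F (h/2))"
      by measurable
    then show ?thesis by (simp add: A_def space_F)
  qed
  have [measurable]: "W h \<in> borel_measurable M" "W (h/2) \<in> borel_measurable M" "W 0 \<in> borel_measurable M"
    using h by auto
  have "ennreal p \<le> emeasure M A"
    unfolding p_def A_def by (rule normal_interval_prob[OF D2 \<sigma>]) simp
  then have pA: "p \<le> prob A"
    by (simp add: emeasure_eq_measure)
  have "ennreal p \<le> emeasure M ((\<lambda>\<omega>. (W h \<omega> - W (h/2) \<omega>) $ j) -` {\<sigma>..2*\<sigma>} \<inter> space M)"
    unfolding p_def by (rule normal_interval_prob[OF D1 \<sigma>]) simp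
  also have "(\<lambda>\<omega>. (W h \<omega> - W (h/2) \<omega>) $ j) -` {\<sigma>..2*\<sigma>} \<inter> space M = C"
    by (auto simp: C_def B_def)
  finally have pC: "p \<le> prob C"
    by (simp add: emeasure_eq_measure)
  have "p\<^sup>2 \<le> prob A * prob C"
    unfolding power2_eq_square using pA pC p by (intro mult_mono) auto
  also have "\<dots> = prob (A \<inter> C)"
    unfolding C_def by (rule increment_indep_event[symmetric, OF st(1,2) A B])
  also have "\<dots> \<le> prob {\<omega>\<in>space M. sqrt h \<le> (W h \<omega> - W (h/2) \<omega>) $ j - (W (h/2) \<omega> - W 0 \<omega>) $ j}"
  proof (rule finite_measure_mono)
    have "sqrt h \<le> 2 * \<sigma>"
      using h by (intro real_le_lsqrt) (auto simp: \<sigma>_def power_mult_distrib)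
    then show "A \<inter> C \<subseteq> {\<omega>\<in>space M. sqrt h \<le> (W h \<omega> - W (h/2) \<omega>) $ j - (W (h/2) \<omega> - W 0 \<omega>) $ j}"
      by (auto simp: A_def B_def C_def)
  qed measurable
  finally show ?thesis by (simp add: p_def)
qed

end

text \<open>
  Reduces a condition on a whole path to countably many times, which makes the corresponding event
  measurable.
\<close>

lemma rational_bound_imp_bound:
  fixes f :: "real \<Rightarrow> 'b::real_normed_vector"
  assumes "continuous_on {0..t} f" "0 < t" "\<And>q. q \<in> {0<..<t} \<inter> \<rat> \<Longrightarrow> norm (f q) \<le> r" "s \<in> {0..t}"
  shows "norm (f s) \<le> r"
proof (rule continuous_on_closure_norm_le[of "{0<..<t} \<inter> \<rat>" f r s])
  have "closure ({0<..<t} \<inter> \<rat>) = {0..t}"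
    using assms(2) by (subst closure_open_Int_superset) (auto simp: Rats_closure_real)
  then show "continuous_on (closure ({0<..<t} \<inter> \<rat>)) f" "s \<in> closure ({0<..<t} \<inter> \<rat>)"
    using assms by auto
qed (use assms in auto)

locale diffusion = brownian M F W
  for M :: "'a measure" and F :: "real \<Rightarrow> 'a measure" and W :: "real \<Rightarrow> 'a \<Rightarrow> real^'r" +
  fixes a :: "real^'r \<Rightarrow> real^'r" and b :: "real^'r \<Rightarrow> real^'r^'r" and x0 :: "real^'r"
    and X :: "real \<Rightarrow> 'a \<Rightarrow> real^'r"
  assumes solution: "sde_solution a b x0 M F W X"
begin

lemma X_measurable [measurable]: "t \<in> {0..1} \<Longrightarrow> X t \<in> borel_measurable M"
  and X_continuous: "\<omega> \<in> space M \<Longrightarrow> continuous_on {0..1} (\<lambda>t. X t \<omega>)"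
  and X_start: "AE \<omega> in M. X 0 \<omega> = x0"
  using solution measurable_F unfolding sde_solution_def by blast+

lemma X_equation:
  assumes "t \<in> {0..1}"
  obtains I where "has_ito_integral M F W (\<lambda>s \<omega>. b (X s \<omega>)) t I"
    and "AE \<omega> in M. X t \<omega> = x0 + integral {0..t} (\<lambda>s. a (X s \<omega>)) + I \<omega>"
  using solution assms unfolding sde_solution_def by blast

text \<open>
  The events that \<open>X\<close> stays \<open>\<rho>\<close>-close to \<open>x0\<close> up to time \<open>1/(n+1)\<close> increase with \<open>n\<close>, and by
  continuity of the paths they exhaust the space up to a null set.
\<close>

lemma stays_near_start:
  assumes \<rho>: "0 < \<rho>" and p: "0 < p"
  obtains t G where "0 < t" "t \<le> 1" "G \<in> sets M" "prob (space M - G) \<le> p"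
    "\<And>\<omega> s. \<omega> \<in> G \<Longrightarrow> s \<in> {0..t} \<Longrightarrow> norm (X s \<omega> - x0) \<le> \<rho>"
proof -
  define t where "t n = 1 / real (Suc n)" for n
  have t: "0 < t n" "t n \<le> 1" for n by (auto simp: t_def)
  define G where "G n = {\<omega>\<in>space M. \<forall>q\<in>{0<..<t n} \<inter> \<rat>. norm (X q \<omega> - x0) \<le> \<rho>}" for n
  have [measurable]: "G n \<in> sets M" for n
  proof -
    have "countable ({0<..<t n} \<inter> \<rat>)"
      using countable_rat by (rule countable_subset[rotated]) auto
    moreover have "{\<omega>\<in>space M. norm (X q \<omega> - x0) \<le> \<rho>} \<in> sets M" if "q \<in> {0<..<t n} \<inter> \<rat>" for q
    proof -
      have [measurable]: "X q \<in> borel_measurable M" using that t(2)[of n] by (intro X_measurable) auto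
      show ?thesis by measurable
    qed
    ultimately show ?thesis
      unfolding G_def by (intro sets.sets_Collect_countable_All')
  qed
  have "incseq G"
  proof (rule incseq_SucI)
    fix n
    have "t (Suc n) \<le> t n" by (simp add: t_def frac_le)
    then show "G n \<le> G (Suc n)" by (auto simp: G_def)
  qed
  then have lim: "(\<lambda>n. prob (G n)) \<longlonglongrightarrow> prob (\<Union>n. G n)"
    by (intro finite_Lim_measure_incseq) auto
  have "AE \<omega> in M. \<omega> \<in> (\<Union>n. G n)"
    using X_start
  proof (rule AE_mp, intro AE_I2 impI)
    fix \<omega> assume \<omega>: "\<omega> \<in> space M" and start: "X 0 \<omega> = x0"
    obtain d where d: "0 < d" "\<And>s. s \<in> {0..1} \<Longrightarrow> dist s 0 < d \<Longrightarrow> dist (X s \<omega>) (X 0 \<omega>) < \<rho>"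
      using X_continuous[OF \<omega>] \<rho> unfolding continuous_on_iff by (metis atLeastAtMost_iff order_refl zero_le_one)
    obtain n where n: "t n < d"
      using reals_Archimedean[OF d(1)] by (auto simp: t_def inverse_eq_divide)
    have "norm (X q \<omega> - x0) \<le> \<rho>" if "q \<in> {0<..<t n}" for q
      using d(2)[of q] that n t(2)[of n] start by (auto simp: dist_norm)
    then have "\<omega> \<in> G n" using \<omega> by (auto simp: G_def)
    then show "\<omega> \<in> (\<Union>n. G n)" by blast
  qed
  then have "prob (\<Union>n. G n) = 1"
    by (subst prob_eq_1) auto
  with lim obtain n where "1 - p < prob (G n)"
    using order_tendstoD(1)[OF lim, of "1 - p"] p by (auto simp: eventually_sequentially)
  then have "prob (space M - G n) \<le> p"
    by (subst prob_compl) auto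
  moreover have "norm (X s \<omega> - x0) \<le> \<rho>" if "\<omega> \<in> G n" "s \<in> {0..t n}" for \<omega> s
  proof (rule rational_bound_imp_bound[where f="\<lambda>s. X s \<omega> - x0"])
    show "continuous_on {0..t n} (\<lambda>s. X s \<omega> - x0)"
      using that t by (intro continuous_intros continuous_on_subset[OF X_continuous]) (auto simp: G_def intro: order_trans)
  qed (use that t in \<open>auto simp: G_def\<close>)
  ultimately show thesis
    using that[of "t n" "G n"] t by auto
qed

text \<open>
  The vector \<open>u\<close> is chosen such that \<open>u \<bullet> (b x0 *v w)\<close> is a coordinate of \<open>w\<close>.  Tested against \<open>u\<close>,
  the second difference of \<open>X\<close> is the second difference of a coordinate of \<open>W\<close>, which is at least
  \<open>sqrt h\<close> with probability at least \<open>p\<close>, plus the drift and the two deviations \<open>R1\<close> and \<open>R2\<close> of the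
  Ito integrals from \<open>b x0 *v (W h - W 0)\<close> and \<open>b x0 *v (W (h/2) - W 0)\<close>.  These perturbations enter
  with total weight 4 and are at most \<open>sqrt h / 8\<close> each, outside exceptional events that are too small
  to exhaust the probability \<open>p\<close>.
\<close>

lemma second_difference_lower_bound:
  assumes lip: "L-lipschitz_on UNIV a" and cont: "isCont b x0" and det: "det (b x0) \<noteq> 0"
  obtains q p h0 where "0 < q" "0 < p" "0 < h0" "h0 \<le> 1"
    "\<And>h. 0 < h \<Longrightarrow> h \<le> h0 \<Longrightarrow>
      p \<le> prob {\<omega>\<in>space M. q * sqrt h \<le> norm (X 0 \<omega> - 2 *\<^sub>R X (h/2) \<omega> + X h \<omega>)}"
proof -
  obtain j :: 'r where True by blast
  obtain B where B: "B ** b x0 = mat 1"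
    using det invertible_det_nz[of "b x0"] unfolding invertible_def by blast
  define u where "u = axis j 1 v* B"
  have u: "u \<bullet> (b x0 *v w) = w $ j" for w
    by (simp add: u_def dot_lmul_matrix[symmetric] vector_matrix_mul_assoc B)
      (simp add: inner_axis')
  have u0: "0 < norm u"
    using u[of "axis j 1"] by (auto simp: axis_def)
  define p where "p = (exp (-2) / sqrt (2 * pi))\<^sup>2"
  have p: "0 < p" by (simp add: p_def)
  define D where "D = real CARD('r)"
  have D: "0 < D" by (simp add: D_def)
  \<comment> \<open>With this \<open>r\<close>, and \<open>\<delta> = sqrt h / 8\<close>, the second term in the deviation inequality for Ito
    integrals is \<open>1024 D (\<bar>u\<bar> r)\<^sup>2 = p / 8\<close>.\<close>
  define r where "r = sqrt (p / (8192 * D)) / norm u"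
  have r: "0 < r" using p D u0 by (simp add: r_def)
  have ur: "1024 * D * (norm u * r)\<^sup>2 = p / 8"
    using u0 p D by (simp add: r_def)
  obtain \<rho> where \<rho>: "0 < \<rho>" "\<rho> \<le> 1" and near: "\<And>x. norm (x - x0) \<le> \<rho> \<Longrightarrow> norm (b x - b x0) \<le> r"
  proof -
    from cont obtain d where d: "0 < d" "\<And>x. dist x x0 < d \<Longrightarrow> dist (b x) (b x0) < r"
      using r unfolding continuous_at_eps_delta by blast
    show thesis
    proof (rule that[of "min 1 (d/2)"])
      fix x assume "norm (x - x0) \<le> min 1 (d/2)"
      then show "norm (b x - b x0) \<le> r"
        using d(2)[of x] d(1) by (auto simp: dist_norm)
    qed (use d in auto)
  qed
  obtain t G where t: "0 < t" "t \<le> 1" and G[measurable]: "G \<in> sets M" and pG: "prob (space M - G) \<le> p / 8"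
    and XG: "\<And>\<omega> s. \<omega> \<in> G \<Longrightarrow> s \<in> {0..t} \<Longrightarrow> norm (X s \<omega> - x0) \<le> \<rho>"
    using stays_near_start[OF \<rho>(1), of "p / 8"] p by auto
  define K where "K = norm (a x0) + L"
  have L: "0 \<le> L" using lip by (rule lipschitz_on_nonneg)
  have K: "0 \<le> K" using L by (simp add: K_def)
  have drift: "norm (integral {0..s} (\<lambda>s. a (X s \<omega>))) \<le> K * s" if "\<omega> \<in> G" "0 \<le> s" "s \<le> t" for \<omega> s
  proof -
    have \<omega>: "\<omega> \<in> space M" using that(1) G sets.sets_into_space by blast
    have "norm (integral {0..s} (\<lambda>s. a (X s \<omega>))) \<le> K * (s - 0)"
    proof (rule integral_bound)
      show "continuous_on {0..s} (\<lambda>s. a (X s \<omega>))"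
        using that t by (intro continuous_on_compose2[OF lipschitz_on_continuous_on[OF lip]]
            continuous_on_subset[OF X_continuous[OF \<omega>]]) auto
      fix v assume v: "v \<in> {0..s}"
      have "norm (a (X v \<omega>) - a x0) \<le> L * norm (X v \<omega> - x0)"
        using lipschitz_onD[OF lip, of "X v \<omega>" x0] by (simp add: dist_norm)
      also have "\<dots> \<le> L * 1"
        using XG[OF that(1), of v] v that \<rho> L by (intro mult_left_mono) auto
      finally show "norm (a (X v \<omega>)) \<le> K"
        using norm_triangle_sub[of "a (X v \<omega>)" "a x0"] by (simp add: K_def)
    qed (use that in auto)
    then show ?thesis by simp
  qed
  \<comment> \<open>Below \<open>h0\<close> the drift, of size at most \<open>2 K h\<close>, contributes at most \<open>sqrt h / 8\<close>.\<close>
  define h0 where "h0 = min t ((1 / (16 * norm u * (K + 1)))\<^sup>2)"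
  have h0: "0 < h0" "h0 \<le> t" using t u0 K by (auto simp: h0_def)
  have main: "p / 4 \<le> prob {\<omega>\<in>space M. 1 / (2 * norm u) * sqrt h \<le> norm (X 0 \<omega> - 2 *\<^sub>R X (h/2) \<omega> + X h \<omega>)}"
    if h: "0 < h" "h \<le> h0" for h
  proof -
    have ht: "h \<le> t" "h / 2 \<le> t" "h \<in> {0..1}" "h/2 \<in> {0..1}" using h h0 t by auto
    have small: "norm u * (2 * K * h) \<le> sqrt h / 8"
    proof -
      have "sqrt h \<le> 1 / (16 * norm u * (K + 1))"
        using h u0 K by (intro real_le_lsqrt) (auto simp: h0_def)
      moreover have "0 < 16 * norm u * (K + 1)"
        using u0 K by simp
      ultimately have "16 * norm u * (K + 1) * sqrt h \<le> 1"
        by (simp only: pos_le_divide_eq mult.commute)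
      moreover have "16 * norm u * K * sqrt h \<le> 16 * norm u * (K + 1) * sqrt h"
        using u0 K h by (intro mult_right_mono mult_left_mono) auto
      ultimately have "16 * norm u * K * sqrt h * sqrt h \<le> 1 * sqrt h"
        using h by (intro mult_right_mono) auto
      then have "16 * norm u * K * (sqrt h * sqrt h) \<le> sqrt h"
        by (simp only: mult.assoc mult_1)
      moreover have "sqrt h * sqrt h = h" using h by simp
      ultimately show ?thesis by simp
    qed
    obtain I1 where I1: "has_ito_integral M F W (\<lambda>s \<omega>. b (X s \<omega>)) h I1"
      and X1: "AE \<omega> in M. X h \<omega> = x0 + integral {0..h} (\<lambda>s. a (X s \<omega>)) + I1 \<omega>"
      using X_equation[OF ht(3)] .
    obtain I2 where I2: "has_ito_integral M F W (\<lambda>s \<omega>. b (X s \<omega>)) (h/2) I2"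
      and X2: "AE \<omega> in M. X (h/2) \<omega> = x0 + integral {0..h/2} (\<lambda>s. a (X s \<omega>)) + I2 \<omega>"
      using X_equation[OF ht(4)] .
    define R1 where "R1 \<omega> = u \<bullet> (I1 \<omega> - b x0 *v (W h \<omega> - W 0 \<omega>))" for \<omega>
    define R2 where "R2 \<omega> = u \<bullet> (I2 \<omega> - b x0 *v (W (h/2) \<omega> - W 0 \<omega>))" for \<omega>
    have [measurable]: "I1 \<in> borel_measurable M" "I2 \<in> borel_measurable M"
      using I1 I2 by (auto simp: has_ito_integral_def)
    have [measurable]: "W h \<in> borel_measurable M" "W (h/2) \<in> borel_measurable M" "W 0 \<in> borel_measurable M"
      "X h \<in> borel_measurable M" "X (h/2) \<in> borel_measurable M" "X 0 \<in> borel_measurable M"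
      using h ht by auto
    have R_eq: "R1 \<omega> = u \<bullet> I1 \<omega> - (W h \<omega> - W 0 \<omega>) $ j" "R2 \<omega> = u \<bullet> I2 \<omega> - (W (h/2) \<omega> - W 0 \<omega>) $ j" for \<omega>
      by (simp_all only: R1_def R2_def inner_diff_right[of u] u)
    have [measurable]: "R1 \<in> borel_measurable M" "R2 \<in> borel_measurable M"
      unfolding R_eq[abs_def] by measurable
    define E where "E = {\<omega>\<in>space M. sqrt h \<le> (W h \<omega> - W (h/2) \<omega>) $ j - (W (h/2) \<omega> - W 0 \<omega>) $ j}"
    define E1 where "E1 = {\<omega>\<in>space M. sqrt h / 8 < \<bar>R1 \<omega>\<bar>}"
    define E2 where "E2 = {\<omega>\<in>space M. sqrt h / 8 < \<bar>R2 \<omega>\<bar>}"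
    define Z where "Z = {\<omega>\<in>space M. 1 / (2 * norm u) * sqrt h \<le> norm (X 0 \<omega> - 2 *\<^sub>R X (h/2) \<omega> + X h \<omega>)}"
    have sets: "E \<in> sets M" "E1 \<in> sets M" "E2 \<in> sets M" "Z \<in> sets M" "space M - G \<in> sets M"
      unfolding E_def E1_def E2_def Z_def by measurable
    have pE: "p \<le> prob E"
      unfolding p_def E_def by (rule opposite_increments_prob[OF h(1)])
    have near1: "norm (b (X s \<omega>) - b x0) \<le> r" if "\<omega> \<in> G" "s \<in> {0..h}" for \<omega> s
      using near XG[OF that(1), of s] that ht by auto
    have sq: "(norm u * r / (sqrt h / 8))\<^sup>2 = 64 * (norm u * r)\<^sup>2 / h"
      using h by (simp add: power_divide field_simps)
    have pE1: "prob E1 \<le> p / 4"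
    proof -
      have "prob E1 \<le> prob (space M - G) + 16 * real CARD('r) * h * (norm u * r / (sqrt h / 8))\<^sup>2"
        unfolding E1_def R1_def
        by (rule ito_integral_deviation[OF I1 h(1) G near1 r]) (use h in auto)
      also have "16 * real CARD('r) * h * (norm u * r / (sqrt h / 8))\<^sup>2 = 1024 * D * (norm u * r)\<^sup>2"
        unfolding sq using h by (simp add: D_def)
      finally show ?thesis using pG ur by simp
    qed
    have pE2: "prob E2 \<le> p / 4"
    proof -
      have "prob E2 \<le> prob (space M - G) + 16 * real CARD('r) * (h / 2) * (norm u * r / (sqrt h / 8))\<^sup>2"
        unfolding E2_def R2_def
        by (rule ito_integral_deviation[OF I2 _ G near1 r]) (use h in auto)
      also have "16 * real CARD('r) * (h / 2) * (norm u * r / (sqrt h / 8))\<^sup>2 = 512 * D * (norm u * r)\<^sup>2"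
        unfolding sq using h by (simp add: D_def)
      also have "\<dots> \<le> 1024 * D * (norm u * r)\<^sup>2"
        using D by (intro mult_right_mono) auto
      finally show ?thesis using pG ur by simp
    qed
    have "AE \<omega> in M. \<omega> \<in> E \<longrightarrow> \<omega> \<in> E1 \<union> (E2 \<union> ((space M - G) \<union> Z))"
      using X1 X2 X_start
    proof eventually_elim
      case (elim \<omega>)
      show ?case
      proof (intro impI, rule ccontr)
        assume \<omega>E: "\<omega> \<in> E" and "\<omega> \<notin> E1 \<union> (E2 \<union> ((space M - G) \<union> Z))"
        then have \<omega>: "\<omega> \<in> space M" "\<omega> \<in> G" and R: "\<bar>R1 \<omega>\<bar> \<le> sqrt h / 8" "\<bar>R2 \<omega>\<bar> \<le> sqrt h / 8"
          and nZ: "\<omega> \<notin> Z"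
          by (auto simp: E_def E1_def E2_def)
        let ?d1 = "integral {0..h} (\<lambda>s. a (X s \<omega>))" and ?d2 = "integral {0..h/2} (\<lambda>s. a (X s \<omega>))"
        let ?Z = "X 0 \<omega> - 2 *\<^sub>R X (h/2) \<omega> + X h \<omega>"
        have "\<bar>u \<bullet> (?d1 - 2 *\<^sub>R ?d2)\<bar> \<le> norm u * norm (?d1 - 2 *\<^sub>R ?d2)"
          by (rule Cauchy_Schwarz_ineq2)
        also have "\<dots> \<le> norm u * (K * h + 2 * (K * (h/2)))"
        proof (rule mult_left_mono)
          have "norm (?d1 - 2 *\<^sub>R ?d2) \<le> norm ?d1 + 2 * norm ?d2"
            using norm_triangle_ineq4[of ?d1 "2 *\<^sub>R ?d2"] by simp
          then show "norm (?d1 - 2 *\<^sub>R ?d2) \<le> K * h + 2 * (K * (h/2))"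
            using drift[OF \<omega>(2), of h] drift[OF \<omega>(2), of "h/2"] h ht by simp
        qed simp
        also have "\<dots> \<le> sqrt h / 8"
          using small by simp
        finally have d: "\<bar>u \<bullet> (?d1 - 2 *\<^sub>R ?d2)\<bar> \<le> sqrt h / 8" .
        have "?Z = (?d1 - 2 *\<^sub>R ?d2) + (I1 \<omega> - 2 *\<^sub>R I2 \<omega>)"
          unfolding elim by (simp add: algebra_simps scaleR_2)
        then have "u \<bullet> ?Z = u \<bullet> (?d1 - 2 *\<^sub>R ?d2) + (u \<bullet> I1 \<omega> - 2 * (u \<bullet> I2 \<omega>))"
          by (simp only: inner_add_right inner_diff_right[of u "I1 \<omega>"] inner_scaleR_right)
        also have "u \<bullet> I1 \<omega> - 2 * (u \<bullet> I2 \<omega>) = R1 \<omega> - 2 * R2 \<omega>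
            + ((W h \<omega> - W (h/2) \<omega>) $ j - (W (h/2) \<omega> - W 0 \<omega>) $ j)"
          unfolding R_eq by (simp add: algebra_simps)
        finally have "sqrt h / 2 \<le> u \<bullet> ?Z"
          using \<omega>E R d h unfolding E_def by (simp only: mem_Collect_eq) linarith
        also have "\<dots> \<le> norm u * norm ?Z"
          by (rule norm_cauchy_schwarz)
        finally have "1 / (2 * norm u) * sqrt h \<le> norm ?Z"
          using u0 by (simp add: field_simps)
        then show False using nZ \<omega> by (simp add: Z_def)
      qed
    qed
    then have "prob E \<le> prob (E1 \<union> (E2 \<union> ((space M - G) \<union> Z)))"
      by (rule finite_measure_mono_AE) (use sets in auto)
    also have "\<dots> \<le> prob E1 + prob (E2 \<union> ((space M - G) \<union> Z))"
      by (rule measure_Un_le) (use sets in auto)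
    also have "prob (E2 \<union> ((space M - G) \<union> Z)) \<le> prob E2 + prob ((space M - G) \<union> Z)"
      by (rule measure_Un_le) (use sets in auto)
    also have "prob ((space M - G) \<union> Z) \<le> prob (space M - G) + prob Z"
      by (rule measure_Un_le) (use sets in auto)
    finally have "p / 4 \<le> prob Z"
      using pE pE1 pE2 pG p by linarith
    then show ?thesis unfolding Z_def .
  qed
  show thesis
    by (rule that[of "1 / (2 * norm u)" "p / 4" h0]) (use main u0 p h0 t in auto)
qed

end

section \<open>A Lipschitz functional that vanishes at all cheap nodes\<close>

text \<open>
  The factor 1/4 makes the functional Lipschitz with constant 1, and the truncation at \<open>sqrt h\<close>, the
  typical size of the second difference, makes it bounded.
\<close>

definition second_difference_functional :: "real \<Rightarrow> (real \<Rightarrow> real^'r) \<Rightarrow> real" where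
  "second_difference_functional h x = min (sqrt h) (norm (x 0 - 2 *\<^sub>R x (h/2) + x h) / 4)"

lemma norm_le_mdist_path_space:
  assumes x: "x \<in> mspace path_space" and y: "y \<in> mspace path_space" and t: "t \<in> {0..1}"
  shows "norm (x t - y t) \<le> mdist path_space x y"
proof -
  have "continuous_on {0..1} (\<lambda>t. norm (x t - y t))"
    using x y by (auto simp: mspace_path_space intro!: continuous_intros)
  then have "bdd_above ((\<lambda>t. norm (x t - y t)) ` {0..1})"
    by (intro bounded_imp_bdd_above compact_imp_bounded compact_continuous_image) auto
  then show ?thesis
    unfolding mdist_path_space[OF x y] by (rule cSUP_upper[OF t])
qed

lemma second_difference_functional_Lip1:
  assumes h: "0 < h" "h \<le> 1"
  shows "second_difference_functional h \<in> Lip1"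
  unfolding Lip1_def
proof (intro CollectI ballI)
  fix x y :: "real \<Rightarrow> real^'r" assume xy: "x \<in> mspace path_space" "y \<in> mspace path_space"
  let ?d = "mdist path_space x y"
  let ?D = "\<lambda>x. x 0 - 2 *\<^sub>R x (h/2) + x h :: real^'r"
  note le = norm_le_mdist_path_space[OF xy]
  have "\<bar>norm (?D x) - norm (?D y)\<bar> \<le> norm (?D x - ?D y)"
    by (rule norm_triangle_ineq3)
  also have "?D x - ?D y = (x 0 - y 0) + (- (2 *\<^sub>R (x (h/2) - y (h/2))) + (x h - y h))"
    by (simp add: algebra_simps)
  also have "norm \<dots> \<le> norm (x 0 - y 0) + (norm (- (2 *\<^sub>R (x (h/2) - y (h/2)))) + norm (x h - y h))"
    by (intro order_trans[OF norm_triangle_ineq] add_left_mono norm_triangle_ineq)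
  also have "\<dots> = norm (x 0 - y 0) + (2 * norm (x (h/2) - y (h/2)) + norm (x h - y h))"
    by (simp only: norm_minus_cancel norm_scaleR)
  also have "\<dots> \<le> 4 * ?d"
    using le[of 0] le[of "h/2"] le[of h] h by simp
  finally have "\<bar>norm (?D x) / 4 - norm (?D y) / 4\<bar> \<le> ?d" by simp
  then show "\<bar>second_difference_functional h x - second_difference_functional h y\<bar> \<le> ?d"
    unfolding second_difference_functional_def by linarith
qed

text \<open>
  A path that is piecewise linear with step \<open>2\<^sup>-\<^sup>l\<close> is linear on \<open>[0, 2\<^sup>-\<^sup>l]\<close>, and this interval
  contains the three evaluation points.
\<close>

lemma second_difference_functional_eq_0:
  assumes "l \<le> L" "x \<in> piecewise_linear_paths l"
  shows "second_difference_functional ((1/2) ^ L) x = 0"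
proof -
  from assms(2) obtain u v where uv: "\<And>t. t \<in> {0..1 / 2 ^ l} \<Longrightarrow> x t = u + t *\<^sub>R v"
    unfolding piecewise_linear_paths_def by (auto dest: spec[of _ 0])
  define h where "h = (1/2::real) ^ L"
  have h: "0 \<le> h" "h \<le> 1 / 2 ^ l"
    using power_decreasing[OF assms(1), of "1/2::real"] by (auto simp: h_def power_one_over)
  then have "x 0 = u" "x (h/2) = u + (h/2) *\<^sub>R v" "x h = u + h *\<^sub>R v"
    using uv[of 0] uv[of "h/2"] uv[of h] by auto
  then have "x 0 - 2 *\<^sub>R x (h/2) + x h = 0"
    by (simp add: scaleR_2 algebra_simps)
  then show ?thesis using h by (simp add: second_difference_functional_def h_def[symmetric])
qed

text \<open>
  The lower bound in probability for the second difference becomes one for an expected value.  The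
  truncation is what guarantees integrability, without any moment bound for \<open>X\<close>.
\<close>

lemma (in diffusion) sde_functional_second_difference:
  assumes h: "0 < h" "h \<le> 1" and q: "0 < q"
    and p: "p \<le> prob {\<omega>\<in>space M. q * sqrt h \<le> norm (X 0 \<omega> - 2 *\<^sub>R X (h/2) \<omega> + X h \<omega>)}"
  shows "min 1 (q / 4) * p * sqrt h \<le> sde_functional M X (second_difference_functional h)"
    and "sde_functional M X (\<lambda>x. - second_difference_functional h x) = - sde_functional M X (second_difference_functional h)"
proof -
  define Z where "Z = {\<omega>\<in>space M. q * sqrt h \<le> norm (X 0 \<omega> - 2 *\<^sub>R X (h/2) \<omega> + X h \<omega>)}"
  let ?g = "\<lambda>\<omega>. second_difference_functional h (restrict (\<lambda>t. X t \<omega>) {0..1})"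
  have [measurable]: "X 0 \<in> borel_measurable M" "X (h/2) \<in> borel_measurable M" "X h \<in> borel_measurable M"
    using h by (auto intro!: X_measurable)
  have Z[measurable]: "Z \<in> sets M" unfolding Z_def by measurable
  have g: "?g \<omega> = min (sqrt h) (norm (X 0 \<omega> - 2 *\<^sub>R X (h/2) \<omega> + X h \<omega>) / 4)" for \<omega>
    using h by (simp add: second_difference_functional_def)
  have int: "integrable M ?g"
    unfolding g
  proof (rule integrable_const_bound[where B="sqrt h"])
    show "(\<lambda>\<omega>. min (sqrt h) (norm (X 0 \<omega> - 2 *\<^sub>R X (h/2) \<omega> + X h \<omega>) / 4)) \<in> borel_measurable M"
      by measurable
  qed (use h in \<open>auto simp: abs_if min_def not_le intro!: AE_I2\<close>)
  have "min 1 (q / 4) * p * sqrt h \<le> min 1 (q / 4) * sqrt h * prob Z"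
    using p h q mult_left_mono[of p "prob Z" "min 1 (q / 4) * sqrt h"] by (simp add: Z_def mult_ac)
  also have "\<dots> = (\<integral>\<omega>. min 1 (q / 4) * sqrt h * indicator Z \<omega> \<partial>M)"
    by simp
  also have "\<dots> \<le> (\<integral>\<omega>. ?g \<omega> \<partial>M)"
  proof (rule integral_mono[OF _ int])
    fix \<omega> assume "\<omega> \<in> space M"
    have "min 1 (q / 4) * sqrt h \<le> 1 * sqrt h" "min 1 (q / 4) * sqrt h \<le> q / 4 * sqrt h"
      using h by (intro mult_right_mono; simp)+
    then have "min 1 (q / 4) * sqrt h \<le> ?g \<omega>" if "\<omega> \<in> Z"
      using that unfolding g Z_def by auto
    moreover have "0 \<le> ?g \<omega>"
      unfolding g using h by simp
    ultimately show "min 1 (q / 4) * sqrt h * indicator Z \<omega> \<le> ?g \<omega>"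
      by (cases "\<omega> \<in> Z") auto
  qed (intro integrable_mult_right integrable_real_indicator Z, simp add: emeasure_eq_measure)
  finally show "min 1 (q / 4) * p * sqrt h \<le> sde_functional M X (second_difference_functional h)"
    by (simp add: sde_functional_def)
  show "sde_functional M X (\<lambda>x. - second_difference_functional h x) = - sde_functional M X (second_difference_functional h)"
    by (simp add: sde_functional_def)
qed


section \<open>Algorithms of small cost cannot see the functional\<close>

lemma prob_space_bit_space: "prob_space bit_space"
  unfolding bit_space_def by (intro prob_space_PiM prob_space_measure_pmf)

lemma space_bit_space [simp]: "space bit_space = UNIV"
  by (simp add: bit_space_def space_PiM)

lemma measurable_first_bits [measurable]:
  "(\<lambda>\<omega>. first_bits \<omega> l) \<in> measurable bit_space (count_space UNIV)"
proof (induction l)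
  case (Suc l)
  have [measurable]: "(\<lambda>\<omega>. \<omega> l) \<in> measurable bit_space (count_space UNIV)"
  proof (rule measurable_compose)
    show "(\<lambda>\<omega>. \<omega> l) \<in> measurable bit_space (measure_pmf (pmf_of_set UNIV))"
      unfolding bit_space_def by (rule measurable_component_singleton) simp
  qed simp
  have "(\<lambda>\<omega>. first_bits \<omega> (Suc l)) = (\<lambda>\<omega>. first_bits \<omega> l @ [\<omega> l])"
    by (simp add: first_bits_def)
  moreover have "(\<lambda>\<omega>. (first_bits \<omega> l, \<omega> l)) \<in> measurable bit_space (count_space UNIV)"
    using Suc by measurable
  from measurable_compose[OF this, of "\<lambda>(u, x). u @ [x]" "count_space UNIV"]
  have "(\<lambda>\<omega>. first_bits \<omega> l @ [\<omega> l]) \<in> measurable bit_space (count_space UNIV)"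
    by simp
  ultimately show ?case by simp
qed (simp add: first_bits_def)

lemma observed_values_zero: "observed_values A \<omega> (\<lambda>x. 0) l = replicate l 0"
  by (induction l) (simp_all add: replicate_append_same)

text \<open>
  The assumption speaks of the nodes that the algorithm chooses for the zero functional.  By
  induction these are also the nodes that it chooses for \<open>f\<close>, since only zeros have been observed.
\<close>

lemma observed_values_cong:
  assumes "\<And>j. 1 \<le> j \<Longrightarrow> j \<le> l \<Longrightarrow> f (node_at A \<omega> (\<lambda>x. 0) j) = 0"
  shows "observed_values A \<omega> f l = observed_values A \<omega> (\<lambda>x. 0) l"
  using assms
proof (induction l)
  case (Suc l)
  have "observed_values A \<omega> f l = observed_values A \<omega> (\<lambda>x. 0) l"
    using Suc by simp
  then show ?case
    using Suc.prems[of "Suc l"] by (simp add: node_at_def)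
qed simp

text \<open>
  This form of the stopping time refers to the first \<open>n\<close> bits only, which makes it measurable.
\<close>

lemma num_steps_eq_enat_iff:
  "num_steps A \<omega> f = enat n \<longleftrightarrow>
    1 \<le> n \<and> stop_map A n (first_bits \<omega> n) (observed_values A \<omega> f n) \<and>
    (\<forall>l. 1 \<le> l \<and> l < n \<longrightarrow> \<not> stop_map A l (first_bits \<omega> l) (observed_values A \<omega> f l))"
    (is "?L = enat n \<longleftrightarrow> ?R")
proof -
  define T where "T = {l. 1 \<le> l \<and> stop_map A l (first_bits \<omega> l) (observed_values A \<omega> f l)}"
  have ns: "num_steps A \<omega> f = (INF l\<in>T. enat l)"
    by (simp add: num_steps_def T_def)
  show ?thesis
  proof (cases "T = {}")
    case True
    then have "num_steps A \<omega> f = \<infinity>" by (simp add: ns top_enat_def)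
    then show ?thesis using True by (auto simp: T_def)
  next
    case False
    then have least: "num_steps A \<omega> f = enat (LEAST l. l \<in> T)"
      unfolding ns by (intro antisym INF_greatest INF_lower)
        (auto intro: LeastI_ex Least_le LeastI simp: ex_in_conv[symmetric])
    have "(LEAST l. l \<in> T) = n \<longleftrightarrow> n \<in> T \<and> (\<forall>l<n. l \<notin> T)"
      using False by (metis LeastI Least_le antisym ex_in_conv linorder_not_less not_less_Least)
    then show ?thesis unfolding least by (auto simp: T_def)
  qed
qed

text \<open>
  The event that the algorithm, applied to the zero functional, stops after \<open>n\<close> steps and uses only
  nodes from \<open>G\<close>.  On it no functional that vanishes on \<open>G\<close> can be told from 0.
\<close>

definition blind :: "'p bit_algorithm \<Rightarrow> ('p \<Rightarrow> bool) \<Rightarrow> nat \<Rightarrow> (nat \<Rightarrow> bool) set" where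
  "blind A G n = {\<omega>. num_steps A \<omega> (\<lambda>x. 0) = enat n \<and> (\<forall>l\<in>{1..n}. G (node_at A \<omega> (\<lambda>x. 0) l))}"

lemma alg_output_blind:
  assumes \<omega>: "\<omega> \<in> blind A G n" and f: "\<And>x. G x \<Longrightarrow> f x = 0"
  shows "alg_output A \<omega> f = out_map A n (first_bits \<omega> n) (replicate n 0)"
proof -
  have obs: "observed_values A \<omega> f l = observed_values A \<omega> (\<lambda>x. 0) l" if "l \<le> n" for l
    using \<omega> f that by (intro observed_values_cong) (auto simp: blind_def)
  have "num_steps A \<omega> f = enat n"
    using \<omega> obs unfolding blind_def mem_Collect_eq num_steps_eq_enat_iff by auto
  then show ?thesis
    using obs[of n] by (simp add: alg_output_def observed_values_zero)
qed

text \<open>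
  The maps of an algorithm are arbitrary.  Measurability holds because for the zero functional the
  observed values are known in advance, so that everything is a function of finitely many bits.
\<close>

lemma measurable_steps:
  "Measurable.pred bit_space (\<lambda>\<omega>. num_steps A \<omega> (\<lambda>x. 0) = enat n)"
  "Measurable.pred bit_space (\<lambda>\<omega>. G (node_at A \<omega> (\<lambda>x. 0) l))"
  "Measurable.pred bit_space (\<lambda>\<omega>. Q (out_map A n (first_bits \<omega> n) y))"
proof -
  have *: "Measurable.pred bit_space (\<lambda>\<omega>. R (first_bits \<omega> l))" for l and R :: "bool list \<Rightarrow> bool"
    by (rule measurable_compose[OF measurable_first_bits]) simp
  show "Measurable.pred bit_space (\<lambda>\<omega>. num_steps A \<omega> (\<lambda>x. 0) = enat n)"
    unfolding num_steps_eq_enat_iff observed_values_zero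
    by (intro pred_intros_logic pred_intros_countable *)
  show "Measurable.pred bit_space (\<lambda>\<omega>. G (node_at A \<omega> (\<lambda>x. 0) l))"
    unfolding node_at_def observed_values_zero by (rule *)
  show "Measurable.pred bit_space (\<lambda>\<omega>. Q (out_map A n (first_bits \<omega> n) y))"
    by (rule *)
qed

lemma sets_blind [measurable]: "blind A G n \<in> sets bit_space"
proof -
  note [measurable] = measurable_steps
  have "{\<omega>\<in>space bit_space. num_steps A \<omega> (\<lambda>x. 0) = enat n \<and> (\<forall>l\<in>{1..n}. G (node_at A \<omega> (\<lambda>x. 0) l))}
      \<in> sets bit_space"
    by measurable
  then show ?thesis by (simp add: blind_def)
qed

lemma node_cost_ge:
  assumes "\<And>l. l \<le> L \<Longrightarrow> x \<notin> piecewise_linear_paths l"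
  shows "2 ^ Suc L + 1 \<le> node_cost x"
  unfolding node_cost_def
proof (rule INF_greatest)
  fix l assume "l \<in> {l. x \<in> piecewise_linear_paths l}"
  then have "Suc L \<le> l" using assms by (metis mem_Collect_eq not_less_eq_eq)
  then have "(2::ennreal) ^ Suc L \<le> 2 ^ l"
    by (intro power_increasing) auto
  then show "(2::ennreal) ^ Suc L + 1 \<le> 2 ^ l + 1"
    by (rule add_right_mono)
qed

lemma zero_Lip1: "(\<lambda>x. 0) \<in> Lip1"
  by (simp add: Lip1_def)

text \<open>
  Whenever a node outside the levels up to \<open>L\<close> is used, the cost is at least \<open>2\<^sup>L\<^sup>+\<^sup>1 + 1\<close>.  This is
  more than twice the expected cost, so by Markov's inequality it happens with probability at most 1/2.
\<close>

lemma prob_blind_ge: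
  fixes A :: "(real \<Rightarrow> real^'r) bit_algorithm" and L :: nat
  defines "G \<equiv> \<lambda>x. \<exists>l\<le>L. x \<in> piecewise_linear_paths l"
  assumes A: "A \<in> bit_algorithms" and cost: "cost_at A (\<lambda>x. 0) \<le> 2 ^ L"
  shows "1/2 \<le> measure bit_space (\<Union>n. blind A G n)"
proof -
  interpret B: prob_space bit_space by (rule prob_space_bit_space)
  note [measurable] = measurable_steps
  define U where "U = (\<Union>n. {\<omega>\<in>space bit_space. num_steps A \<omega> (\<lambda>x. 0) = enat n})"
  define H where "H = U - (\<Union>n. blind A G n)"
  have [measurable]: "U \<in> sets bit_space" "H \<in> sets bit_space"
    unfolding U_def H_def by measurable
  have H_cost: "2 ^ Suc L + 1 \<le>
      (\<Sum>l. if 1 \<le> l \<and> enat l \<le> num_steps A \<omega> (\<lambda>x. 0) then node_cost (node_at A \<omega> (\<lambda>x. 0) l) else 0)"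
    if "\<omega> \<in> H" for \<omega>
  proof -
    from that obtain n l where n: "num_steps A \<omega> (\<lambda>x. 0) = enat n" and l: "1 \<le> l" "l \<le> n"
      and "\<not> G (node_at A \<omega> (\<lambda>x. 0) l)"
      unfolding H_def U_def blind_def by auto
    then have "2 ^ Suc L + 1 \<le> node_cost (node_at A \<omega> (\<lambda>x. 0) l)"
      by (intro node_cost_ge) (auto simp: G_def)
    also have "\<dots> = (\<Sum>j\<in>{l}. if 1 \<le> j \<and> enat j \<le> num_steps A \<omega> (\<lambda>x. 0)
        then node_cost (node_at A \<omega> (\<lambda>x. 0) j) else 0)"
      using n l by simp
    also have "\<dots> \<le> (\<Sum>j. if 1 \<le> j \<and> enat j \<le> num_steps A \<omega> (\<lambda>x. 0)
        then node_cost (node_at A \<omega> (\<lambda>x. 0) j) else 0)"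
      by (rule sum_le_suminf) auto
    finally show ?thesis .
  qed
  have "ennreal (2 ^ Suc L * B.prob H) = (\<integral>\<^sup>+\<omega>. 2 ^ Suc L * indicator H \<omega> \<partial>bit_space)"
    by (simp add: nn_integral_cmult_indicator ennreal_mult B.emeasure_eq_measure ennreal_power[symmetric])
  also have "\<dots> \<le> cost_at A (\<lambda>x. 0)"
    unfolding cost_at_def
  proof (rule nn_integral_mono)
    fix \<omega>
    have "(2::ennreal) ^ Suc L \<le> 2 ^ Suc L + 1" by simp
    then show "2 ^ Suc L * indicator H \<omega> \<le> (\<Sum>l. if 1 \<le> l \<and> enat l \<le> num_steps A \<omega> (\<lambda>x. 0)
        then node_cost (node_at A \<omega> (\<lambda>x. 0) l) else 0)"
      using order_trans[OF _ H_cost[of \<omega>], of "2 ^ Suc L"] by (simp add: indicator_def del: power_Suc)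
  qed
  also have "\<dots> \<le> ennreal (2 ^ L)"
    using cost by (simp add: ennreal_power[symmetric])
  finally have H: "B.prob H \<le> 1/2" by simp
  have "AE \<omega> in bit_space. num_steps A \<omega> (\<lambda>x. 0) < \<infinity>"
    using A zero_Lip1 unfolding bit_algorithms_def by blast
  then have "AE \<omega> in bit_space. \<omega> \<in> U"
    by eventually_elim (auto simp: U_def)
  then have "B.prob U = 1"
    by (subst B.prob_eq_1) auto
  moreover have "B.prob U \<le> B.prob (H \<union> (\<Union>n. blind A G n))"
    by (rule B.finite_measure_mono) (auto simp: H_def)
  moreover have "\<dots> \<le> B.prob H + B.prob (\<Union>n. blind A G n)"
    by (rule measure_Un_le) auto
  ultimately show ?thesis using H by linarith
qed

lemma error_at_ge:
  assumes E: "E \<in> sets bit_space" "1/4 \<le> measure bit_space E" and v: "0 \<le> v"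
    and dev: "\<And>\<omega>. \<omega> \<in> E \<Longrightarrow> v \<le> \<bar>S f - alg_output A \<omega> f\<bar>"
  shows "ennreal (v / 2) \<le> error_at S A f"
proof -
  interpret B: prob_space bit_space by (rule prob_space_bit_space)
  define I where "I = (\<integral>\<^sup>+ \<omega>. ennreal (\<bar>S f - alg_output A \<omega> f\<bar>\<^sup>2) \<partial>bit_space)"
  have "ennreal (v\<^sup>2 * B.prob E) = (\<integral>\<^sup>+\<omega>. ennreal (v\<^sup>2) * indicator E \<omega> \<partial>bit_space)"
    using E by (simp add: nn_integral_cmult_indicator ennreal_mult B.emeasure_eq_measure)
  also have "\<dots> \<le> I"
    unfolding I_def
  proof (rule nn_integral_mono)
    fix \<omega> show "ennreal (v\<^sup>2) * indicator E \<omega> \<le> ennreal (\<bar>S f - alg_output A \<omega> f\<bar>\<^sup>2)"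
      using power_mono[OF dev[of \<omega>] v, of 2] by (auto simp: indicator_def intro!: ennreal_leI)
  qed
  finally have I: "ennreal (v\<^sup>2 * B.prob E) \<le> I" .
  have "(v / 2)\<^sup>2 \<le> v\<^sup>2 * B.prob E"
    using mult_left_mono[OF E(2), of "v\<^sup>2"] by (simp add: power_divide)
  with I have I': "ennreal ((v/2)\<^sup>2) \<le> I"
    by (meson ennreal_leI order_trans)
  show ?thesis
  proof (cases "I = \<infinity>")
    case False
    then have "(v/2)\<^sup>2 \<le> enn2real I"
      using I' by (metis enn2real_ennreal enn2real_mono infinity_ennreal_def top.not_eq_extremum zero_le_power2)
    then have "v / 2 \<le> sqrt (enn2real I)"
      by (rule real_le_rsqrt)
    then show ?thesis using False
      unfolding error_at_def ennreal_sqrt_def I_def[symmetric] by (simp add: ennreal_leI)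
  qed (unfold error_at_def ennreal_sqrt_def I_def[symmetric], simp)
qed

text \<open>
  On the blind event the outputs for \<open>f\<close> and \<open>-f\<close> agree.  Where this common value is nonpositive the
  algorithm misses \<open>S f\<close> by at least \<open>S f\<close>, and elsewhere it misses \<open>S (-f) = - S f\<close> by at least
  \<open>S f\<close>.  One of the two cases has probability at least 1/4, half of the probability of blindness,
  and the square root in the error turns 1/4 into 1/2.
\<close>

lemma alg_error_ge:
  fixes A :: "(real \<Rightarrow> real^'r) bit_algorithm"
  assumes A: "A \<in> bit_algorithms" and cost: "alg_cost A \<le> 2 ^ L"
    and f: "f \<in> Lip1" "\<And>l x. l \<le> L \<Longrightarrow> x \<in> piecewise_linear_paths l \<Longrightarrow> f x = 0"
    and S: "S (\<lambda>x. - f x) = - S f" "0 \<le> S f"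
  shows "ennreal (S f / 2) \<le> alg_error S A"
proof -
  interpret B: prob_space bit_space by (rule prob_space_bit_space)
  note [measurable] = measurable_steps
  define G where "G = (\<lambda>x::real \<Rightarrow> real^'r. \<exists>l\<le>L. x \<in> piecewise_linear_paths l)"
  define P where "P n \<omega> \<longleftrightarrow> out_map A n (first_bits \<omega> n) (replicate n 0) \<le> 0" for n \<omega>
  have [measurable]: "Measurable.pred bit_space (P n)" for n
    unfolding P_def by (rule measurable_steps)
  define E1 where "E1 = (\<Union>n. blind A G n \<inter> {\<omega>\<in>space bit_space. P n \<omega>})"
  define E2 where "E2 = (\<Union>n. blind A G n \<inter> {\<omega>\<in>space bit_space. \<not> P n \<omega>})"
  have [measurable]: "E1 \<in> sets bit_space" "E2 \<in> sets bit_space"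
    unfolding E1_def E2_def by measurable
  have "cost_at A (\<lambda>x. 0) \<le> 2 ^ L"
    using cost SUP_upper[OF zero_Lip1, of "cost_at A"] unfolding alg_cost_def by (rule order_trans[rotated])
  then have "1/2 \<le> B.prob (\<Union>n. blind A G n)"
    unfolding G_def by (rule prob_blind_ge[OF A])
  also have "\<dots> \<le> B.prob (E1 \<union> E2)"
    by (rule B.finite_measure_mono) (auto simp: E1_def E2_def)
  also have "\<dots> \<le> B.prob E1 + B.prob E2"
    by (rule measure_Un_le) auto
  finally consider "1/4 \<le> B.prob E1" | "1/4 \<le> B.prob E2" by linarith
  then have "ennreal (S f / 2) \<le> error_at S A f \<or> ennreal (S f / 2) \<le> error_at S A (\<lambda>x. - f x)"
  proof cases
    case 1
    have "S f \<le> \<bar>S f - alg_output A \<omega> f\<bar>" if "\<omega> \<in> E1" for \<omega>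
    proof -
      from that obtain n where n: "\<omega> \<in> blind A G n" "P n \<omega>" unfolding E1_def by auto
      have "alg_output A \<omega> f \<le> 0"
        using alg_output_blind[OF n(1), of f] f(2) n(2) unfolding G_def P_def by metis
      then show ?thesis by simp
    qed
    then show ?thesis using error_at_ge[of E1 "S f" S f A] 1 S(2) by auto
  next
    case 2
    have "S f \<le> \<bar>S (\<lambda>x. - f x) - alg_output A \<omega> (\<lambda>x. - f x)\<bar>" if "\<omega> \<in> E2" for \<omega>
    proof -
      from that obtain n where n: "\<omega> \<in> blind A G n" "\<not> P n \<omega>" unfolding E2_def by auto
      have "0 \<le> alg_output A \<omega> (\<lambda>x. - f x)"
        using alg_output_blind[OF n(1), of "\<lambda>x. - f x"] f(2) n(2) unfolding G_def P_def
        by (metis linorder_le_cases minus_zero)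
      then show ?thesis using S by simp
    qed
    then show ?thesis using error_at_ge[of E2 "S f" S "\<lambda>x. - f x" A] 2 S(2) by auto
  qed
  moreover have "(\<lambda>x. - f x) \<in> Lip1"
    using f(1) unfolding Lip1_def by (auto simp: abs_minus_commute)
  ultimately show ?thesis
    using SUP_upper[of f Lip1 "error_at S A"] SUP_upper[of "\<lambda>x. - f x" Lip1 "error_at S A"] f(1)
    unfolding alg_error_def by (auto intro: order_trans)
qed

text \<open>
  For given \<open>\<epsilon>\<close> take the largest \<open>L\<close> such that the functional of level \<open>L\<close> still forces an error
  above \<open>\<epsilon>\<close>, that is \<open>2\<^sup>L < R\<close> with \<open>R = c\<^sup>2 / (4 \<epsilon>\<^sup>2)\<close>.  By maximality \<open>2\<^sup>L\<close> is at least \<open>R / 2\<close>.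
\<close>

lemma comp_bit_lower_bound:
  fixes S :: "((real \<Rightarrow> real^'r) \<Rightarrow> real) \<Rightarrow> real"
  assumes c: "0 < c"
    and f: "\<And>L. K \<le> L \<Longrightarrow> f L \<in> Lip1"
      "\<And>L l x. K \<le> L \<Longrightarrow> l \<le> L \<Longrightarrow> x \<in> piecewise_linear_paths l \<Longrightarrow> f L x = 0"
    and S: "\<And>L. K \<le> L \<Longrightarrow> S (\<lambda>x. - f L x) = - S (f L)"
      "\<And>L. K \<le> L \<Longrightarrow> c * sqrt ((1/2) ^ L) \<le> S (f L)"
  shows "\<exists>c>0. \<exists>\<epsilon>0>0. \<forall>\<epsilon>\<in>{0<..\<epsilon>0}. ennreal (c * \<epsilon> powi (-2)) \<le> comp_bit S \<epsilon>"
proof (intro exI conjI ballI)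
  show "0 < c\<^sup>2 / 8" using c by simp
  show "0 < c / 4 * sqrt ((1/2) ^ K)" using c by simp
  fix \<epsilon> assume "\<epsilon> \<in> {0<..c / 4 * sqrt ((1/2) ^ K)}"
  then have \<epsilon>: "0 < \<epsilon>" "\<epsilon> \<le> c / 4 * sqrt ((1/2) ^ K)" by auto
  define R where "R = c\<^sup>2 / (4 * \<epsilon>\<^sup>2)"
  have R: "0 < R" using c \<epsilon> by (simp add: R_def)
  have iff: "\<epsilon> < c / 2 * sqrt ((1/2) ^ L) \<longleftrightarrow> 2 ^ L < R" for L
  proof -
    have "\<epsilon> < c / 2 * sqrt ((1/2) ^ L) \<longleftrightarrow> \<epsilon>\<^sup>2 < (c / 2 * sqrt ((1/2) ^ L))\<^sup>2"
      using c \<epsilon> power2_less_imp_less[of \<epsilon> "c / 2 * sqrt ((1/2) ^ L)"] power_strict_mono[of \<epsilon> _ 2]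
      by (metis less_imp_le half_gt_zero mult_nonneg_nonneg real_sqrt_ge_zero zero_le_power half_gt_zero_iff zero_less_one zero_less_numeral)
    also have "\<dots> \<longleftrightarrow> 2 ^ L < R"
      using \<epsilon> by (simp add: power_mult_distrib R_def field_simps power_divide)
    finally show ?thesis .
  qed
  have K: "2 ^ K < R"
  proof -
    have "c / 4 * sqrt ((1/2) ^ K) < c / 2 * sqrt ((1/2) ^ K)" using c by simp
    then show ?thesis using \<epsilon> iff by (meson le_less_trans)
  qed
  obtain m :: nat where m: "R < 2 ^ m"
    using real_arch_pow[of 2 R] by auto
  obtain L where L: "K \<le> L" "2 ^ L < R" "R \<le> 2 ^ Suc L"
  proof -
    define L where "L = Max {L. 2 ^ L < R}"
    have fin: "finite {L::nat. 2 ^ L < R}"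
    proof (rule finite_subset)
      show "{L::nat. 2 ^ L < R} \<subseteq> {..m}"
      proof
        fix l :: nat assume "l \<in> {L. 2 ^ L < R}"
        then have "(2::real) ^ l < 2 ^ m" using m less_trans[of "2 ^ l" R "2 ^ m"] by blast
        then show "l \<in> {..m}" using power_less_imp_less_exp[of "2::real" l m] by simp
      qed
    qed simp
    have "L \<in> {L. 2 ^ L < R}" unfolding L_def using fin K by (intro Max_in) auto
    moreover have "K \<le> L" unfolding L_def using fin K by (intro Max_ge) auto
    moreover have "\<not> 2 ^ Suc L < R"
    proof
      assume "2 ^ Suc L < R"
      then have "Suc L \<le> L" unfolding L_def using fin by (intro Max_ge) auto
      then show False by simp
    qed
    ultimately show thesis using that by auto
  qed
  have "ennreal (c\<^sup>2 / 8 * \<epsilon> powi (-2)) \<le> ennreal (2 ^ L)"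
    using L(3) \<epsilon> by (intro ennreal_leI) (simp add: R_def power_int_minus field_simps)
  also have "\<dots> \<le> comp_bit S \<epsilon>"
    unfolding comp_bit_def
  proof (rule INF_greatest, rule ccontr)
    fix A assume "A \<in> {A \<in> bit_algorithms. alg_error S A \<le> ennreal \<epsilon>}"
      and nle: "\<not> ennreal (2 ^ L) \<le> alg_cost A"
    then have A: "A \<in> bit_algorithms" "alg_error S A \<le> ennreal \<epsilon>" by auto
    have cost: "alg_cost A \<le> 2 ^ L"
      using nle by (simp add: ennreal_power[symmetric])
    have pos: "0 \<le> S (f L)"
      using S(2)[OF L(1)] c by (meson less_imp_le mult_nonneg_nonneg order_trans real_sqrt_ge_0_iff
          zero_le_power zero_le_divide_1_iff zero_le_numeral)
    have "ennreal (S (f L) / 2) \<le> alg_error S A"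
      using A(1) cost f(1)[OF L(1)] f(2)[OF L(1)] S(1)[OF L(1)] pos by (rule alg_error_ge)
    then have "S (f L) / 2 \<le> \<epsilon>"
      using A(2) \<epsilon>(1) by (metis ennreal_le_iff less_imp_le order_trans)
    moreover have "\<epsilon> < S (f L) / 2"
      using iff[of L] L S(2)[OF L(1)] by simp
    ultimately show False by simp
  qed
  finally show "ennreal (c\<^sup>2 / 8 * \<epsilon> powi (-2)) \<le> comp_bit S \<epsilon>" .
qed

section \<open>The lower bound for the complexity\<close>

theorem theorem15:
  fixes a :: "real^'r \<Rightarrow> real^'r"
    and b :: "real^'r \<Rightarrow> real^'r^'r"
    and x0 :: "real^'r"
    and M :: "'a measure"
    and F :: "real \<Rightarrow> 'a measure"
    and W :: "real \<Rightarrow> 'a \<Rightarrow> real^'r"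
    and X :: "real \<Rightarrow> 'a \<Rightarrow> real^'r"
  assumes a_lipschitz: "\<exists>L. L-lipschitz_on UNIV a"
    and b_partials: "\<And>i j. bounded_partials_upto2 (\<lambda>x. b x $ i $ j)"
    and b_smooth: "\<exists>U. open U \<and> x0 \<in> U \<and> (\<forall>i j. Cinfinity_on U (\<lambda>x. b x $ i $ j))"
    and b_det: "det (b x0) \<noteq> 0"
    and X_solution: "sde_solution a b x0 M F W X"
  shows "\<exists>c>0. \<exists>\<epsilon>0>0. \<forall>\<epsilon>\<in>{0<..\<epsilon>0}.
           ennreal (c * \<epsilon> powi (-2)) \<le> comp_bit (sde_functional M X) \<epsilon>"
proof -
  have bm: "brownian_motion M F W"
    using X_solution by (simp add: sde_solution_def)
  have ps: "prob_space M"
    using bm by (simp add: brownian_motion_def)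
  interpret diffusion M F W a b x0 X
    by (intro diffusion.intro brownian.intro brownian_axioms.intro diffusion_axioms.intro ps bm X_solution)
  obtain L where L: "L-lipschitz_on UNIV a" using a_lipschitz by blast
  have cont: "isCont b x0"
  proof -
    obtain U where U: "open U" "x0 \<in> U" "\<And>i j. Cinfinity_on U (\<lambda>x. b x $ i $ j)"
      using b_smooth by blast
    have "continuous_on U (\<lambda>x. b x $ i $ j)" for i j
      using U(3)[of i j] unfolding Cinfinity_on_def by (metis Ck_on.simps(1))
    then have "isCont (\<lambda>x. b x $ i $ j) x0" for i j
      using U(1,2) continuous_on_eq_continuous_at by blast
    then show ?thesis
      unfolding isCont_def by (intro vec_tendstoI)
  qed
  obtain q p h0 where q: "0 < q" and p: "0 < p" and h0: "0 < h0" "h0 \<le> 1"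
    and lower: "\<And>h. 0 < h \<Longrightarrow> h \<le> h0 \<Longrightarrow>
      p \<le> prob {\<omega>\<in>space M. q * sqrt h \<le> norm (X 0 \<omega> - 2 *\<^sub>R X (h/2) \<omega> + X h \<omega>)}"
    by (rule second_difference_lower_bound[OF L cont b_det]) blast
  obtain L0 where L0: "(1/2::real) ^ L0 < h0"
    using real_arch_pow_inv[OF h0(1), of "1/2"] by auto
  have h: "0 < (1/2::real) ^ L" "(1/2::real) ^ L \<le> h0" "(1/2::real) ^ L \<le> 1" if "L0 \<le> L" for L
  proof -
    have "(1/2::real) ^ L \<le> (1/2) ^ L0" using that by (intro power_decreasing) auto
    then show "(1/2::real) ^ L \<le> h0" "(1/2::real) ^ L \<le> 1"
      using L0 h0 by linarith+
  qed simp
  note functional = sde_functional_second_difference[OF h(1,3) q lower[OF h(1,2)]]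
  show ?thesis
  proof (rule comp_bit_lower_bound[where f="\<lambda>L. second_difference_functional ((1/2) ^ L)" and K=L0])
    show "0 < min 1 (q / 4) * p" using p q by simp
  qed (use h functional in \<open>auto intro: second_difference_functional_Lip1 second_difference_functional_eq_0\<close>)
qed

end
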